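(* Let $(\underline{\mathcal C},\underline x)$ be a $G$-$A$-coring with a fixed grouplike family, $T=A^{\mathrm{co}\,\underline{\mathcal C}}$, and $B\to T$ a ring morphism. Then $(F_7,G_7)$, with $F_7=G_1\circ F_6:\mathcal M_B\to\mathcal M^{G,\underline{\mathcal C}}$ and $G_7=(-)^{\mathrm{co}\,\underline{\mathcal C}}:\mathcal M^{G,\underline{\mathcal C}}\to\mathcal M_B$, is a pair of adjoint functors ($F_7$ is left adjoint to $G_7$).
   Context: $G$ is a group with unit $e$, $A$ is a ring with unit. A $G$-$A$-coring (group coring) $\underline{\mathcal C}$ is a family $(\mathcal C_\alpha)_{\alpha\in G}$ of $A$-bimodules with $A$-bimodule maps $\Delta_{\alpha,\beta}:\mathcal C_{\alpha\beta}\to\mathcal C_\alpha\otimes_A\mathcal C_\beta$ and $\varepsilon:\mathcal C_e\to A$ such that, for all $\alpha,\beta,\gamma\in G$, $(\Delta_{\alpha,\beta}\otimes_A\mathcal C_\gamma)\circ\Delta_{\alpha\beta,\gamma}=(\mathcal C_\alpha\otimes_A\Delta_{\beta,\gamma})\circ\Delta_{\alpha,\beta\gamma}$ and $(\mathcal C_\alpha\otimes_A\varepsilon)\circ\Delta_{\alpha,e}=\mathcal C_\alpha=(\varepsilon\otimes_A\mathcal C_\alpha)\circ\Delta_{e,\alpha}$ (an object also denotes its identity map). A right $\underline{\mathcal C}$-comodule is a right $A$-module $M$ with right $A$-linear maps $\rho_\alpha:M\to M\otimes_A\mathcal C_\alpha$, $\rho_\alpha(m)=m_{[0]}\otimes_Am_{[1,\alpha]}$,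 such that $(M\otimes_A\Delta_{\alpha,\beta})\circ\rho_{\alpha\beta}=(\rho_\alpha\otimes_A\mathcal C_\beta)\circ\rho_\beta$ and $(M\otimes_A\varepsilon)\circ\rho_e=M$; with right $A$-linear maps commuting with all $\rho_\alpha$ these form the category $\mathcal M^{\underline{\mathcal C}}$. A right $G$-$\underline{\mathcal C}$-comodule is a family $\underline M=(M_\alpha)_{\alpha\in G}$ of right $A$-modules with right $A$-linear maps $\rho_{\alpha,\beta}:M_{\alpha\beta}\to M_\alpha\otimes_A\mathcal C_\beta$ such that $(M_\alpha\otimes_A\Delta_{\beta,\gamma})\circ\rho_{\alpha,\beta\gamma}=(\rho_{\alpha,\beta}\otimes_A\mathcal C_\gamma)\circ\rho_{\alpha\beta,\gamma}$ and $(M_\alpha\otimes_A\varepsilon)\circ\rho_{\alpha,e}=M_\alpha$. Morphisms are families of right $A$-linear maps $f_\alpha:M_\alpha\to N_\alpha$ with $(f_\alpha\otimes_A\mathcal C_\beta)\circ\rho_{\alpha,\beta}=\rho_{\alpha,\beta}\circ f_{\alpha\beta}$. The category is $\mathcal M^{G,\underline{\mathcal C}}$. A grouplike family is $\underline x=(x_\alpha)_{\alpha\in G}\in\prod_\alpha\mathcal C_\alpha$ with $\Delta_{\alpha,\beta}(x_{\alpha\beta})=x_\alpha\otimes_Ax_\beta$ and $\varepsilon(x_e)=1$. $A^{\mathrm{co}\,\underline{\mathcal C}}=\{a\in A\mid ax_\alpha=x_\alpha a\ \forall\alpha\in G\}$, a subring of $A$. $F_6:\mathcal M_B\to\mathcal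 M^{\underline{\mathcal C}}$ is $F_6(N)=N\otimes_BA$ with $\rho_\alpha(n\otimes_Ba)=(n\otimes_B1_A)\otimes_Ax_\alpha a$. $G_1:\mathcal M^{\underline{\mathcal C}}\to\mathcal M^{G,\underline{\mathcal C}}$ is $G_1(M)=(\mu_\alpha(M))_{\alpha\in G}$, where $\mu_\alpha(M)$ is an isomorphic copy of $M$ indexed by $\alpha$, with $\rho_{\alpha,\beta}(\mu_{\alpha\beta}(m))=\mu_\alpha(m_{[0]})\otimes_Am_{[1,\beta]}$. So $F_7(N)=(\mu_\alpha(N\otimes_BA))_\alpha$ with $\rho_{\alpha,\beta}(\mu_{\alpha\beta}(n\otimes_Ba))=\mu_\alpha(n\otimes_B1_A)\otimes_Ax_\beta a$. $G_7(\underline M)=\underline M^{\mathrm{co}\,\underline{\mathcal C}}=\{(m_\alpha)_\alpha\in\prod_\alpha M_\alpha\mid\rho_{\alpha,\beta}(m_{\alpha\beta})=m_\alpha\otimes_Ax_\beta\ \forall\alpha,\beta\in G\}$ with componentwise right $B$-action. *)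

theory Defs
  imports "HOL-Algebra.Algebra"
begin

section \<open>Modules and bimodules over arbitrary rings\<close>

text \<open>
  As in the library's record of modules over commutative rings, the inherited fields
  \<open>mult\<close> and \<open>one\<close> carry no meaning.
\<close>

record ('s, 'm) right_module = "'m ring" +
  ract :: "'m \<Rightarrow> 's \<Rightarrow> 'm"

record ('r, 's, 'm) bimodule = "('s, 'm) right_module" +
  lact :: "'r \<Rightarrow> 'm \<Rightarrow> 'm"

locale right_module = S?: ring S + M?: abelian_group M
  for S :: "('s, 'w) ring_scheme" (structure)
    and M :: "('s, 'm, 'x) right_module_scheme" (structure) +
  assumes ract_closed: "\<lbrakk>m \<in> carrier M; s \<in> carrier S\<rbrakk> \<Longrightarrow> ract M m s \<in> carrier M"
    and ract_add: "\<lbrakk>m \<in> carrier M; s \<in> carrier S; t \<in> carrier S\<rbrakk>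
      \<Longrightarrow> ract M m (s \<oplus>\<^bsub>S\<^esub> t) = ract M m s \<oplus>\<^bsub>M\<^esub> ract M m t"
    and add_ract: "\<lbrakk>m \<in> carrier M; n \<in> carrier M; s \<in> carrier S\<rbrakk>
      \<Longrightarrow> ract M (m \<oplus>\<^bsub>M\<^esub> n) s = ract M m s \<oplus>\<^bsub>M\<^esub> ract M n s"
    and ract_mult: "\<lbrakk>m \<in> carrier M; s \<in> carrier S; t \<in> carrier S\<rbrakk>
      \<Longrightarrow> ract M m (s \<otimes>\<^bsub>S\<^esub> t) = ract M (ract M m s) t"
    and ract_one: "m \<in> carrier M \<Longrightarrow> ract M m \<one>\<^bsub>S\<^esub> = m"

locale bimodule = R?: ring R + right_module S M
  for R :: "('r, 'v) ring_scheme" (structure) and S :: "('s, 'w) ring_scheme" (structure)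
    and M :: "('r, 's, 'm, 'x) bimodule_scheme" (structure) +
  assumes lact_closed: "\<lbrakk>r \<in> carrier R; m \<in> carrier M\<rbrakk> \<Longrightarrow> lact M r m \<in> carrier M"
    and add_lact: "\<lbrakk>q \<in> carrier R; r \<in> carrier R; m \<in> carrier M\<rbrakk>
      \<Longrightarrow> lact M (q \<oplus>\<^bsub>R\<^esub> r) m = lact M q m \<oplus>\<^bsub>M\<^esub> lact M r m"
    and lact_add: "\<lbrakk>r \<in> carrier R; m \<in> carrier M; n \<in> carrier M\<rbrakk>
      \<Longrightarrow> lact M r (m \<oplus>\<^bsub>M\<^esub> n) = lact M r m \<oplus>\<^bsub>M\<^esub> lact M r n"
    and mult_lact: "\<lbrakk>q \<in> carrier R; r \<in> carrier R; m \<in> carrier M\<rbrakk>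
      \<Longrightarrow> lact M (q \<otimes>\<^bsub>R\<^esub> r) m = lact M q (lact M r m)"
    and one_lact: "m \<in> carrier M \<Longrightarrow> lact M \<one>\<^bsub>R\<^esub> m = m"
    and lact_ract: "\<lbrakk>r \<in> carrier R; m \<in> carrier M; s \<in> carrier S\<rbrakk>
      \<Longrightarrow> ract M (lact M r m) s = lact M r (ract M m s)"

definition right_linear ::
  "('s, 'w) ring_scheme \<Rightarrow> ('s, 'm, 'x) right_module_scheme \<Rightarrow>
   ('s, 'n, 'y) right_module_scheme \<Rightarrow> ('m \<Rightarrow> 'n) \<Rightarrow> bool" where
  "right_linear S M N f \<longleftrightarrow>
     f \<in> hom (add_monoid M) (add_monoid N) \<and>
     (\<forall>m\<in>carrier M. \<forall>s\<in>carrier S. f (ract M m s) = ract N (f m) s)"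

definition bilinear_map ::
  "('r, 'v) ring_scheme \<Rightarrow> ('s, 'w) ring_scheme \<Rightarrow> ('r, 's, 'm, 'x) bimodule_scheme \<Rightarrow>
   ('r, 's, 'n, 'y) bimodule_scheme \<Rightarrow> ('m \<Rightarrow> 'n) \<Rightarrow> bool" where
  "bilinear_map R S M N f \<longleftrightarrow>
     right_linear S M N f \<and>
     (\<forall>r\<in>carrier R. \<forall>m\<in>carrier M. f (lact M r m) = lact N r (f m))"

text \<open>The ring \<open>A\<close> as a \<open>B\<close>-\<open>A\<close>-bimodule, for a ring morphism \<open>f\<close> from \<open>B\<close> to \<open>A\<close>.\<close>

definition ring_bimodule :: "('r \<Rightarrow> 'a) \<Rightarrow> ('a, 'w) ring_scheme \<Rightarrow> ('r, 'a, 'a) bimodule" where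
  "ring_bimodule f A =
     \<lparr>carrier = carrier A, monoid.mult = monoid.mult A, one = one A, ring.zero = ring.zero A, ring.add = ring.add A,
      ract = monoid.mult A, lact = (\<lambda>r a. f r \<otimes>\<^bsub>A\<^esub> a)\<rparr>"


section \<open>Tensor products over a non-commutative ring\<close>

text \<open>
  \<open>M \<otimes>\<^sub>R N\<close> is the free abelian group on \<open>M \<times> N\<close> modulo the subgroup generated by the usual
  relations, so that its elements are cosets in the free abelian group.
\<close>

definition tensor_relations ::
  "('r, 'w) ring_scheme \<Rightarrow> ('r, 'm, 'x) right_module_scheme \<Rightarrow>
   ('r, 's, 'n, 'y) bimodule_scheme \<Rightarrow> ('m \<times> 'n \<Rightarrow>\<^sub>0 int) set" where
  "tensor_relations R M N =
     {frag_of (m \<oplus>\<^bsub>M\<^esub> m', n) - frag_of (m, n) - frag_of (m', n) | m m' n.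
        m \<in> carrier M \<and> m' \<in> carrier M \<and> n \<in> carrier N} \<union>
     {frag_of (m, n \<oplus>\<^bsub>N\<^esub> n') - frag_of (m, n) - frag_of (m, n') | m n n'.
        m \<in> carrier M \<and> n \<in> carrier N \<and> n' \<in> carrier N} \<union>
     {frag_of (ract M m r, n) - frag_of (m, lact N r n) | m r n.
        m \<in> carrier M \<and> r \<in> carrier R \<and> n \<in> carrier N}"

definition tensor_subgroup ::
  "('r, 'w) ring_scheme \<Rightarrow> ('r, 'm, 'x) right_module_scheme \<Rightarrow>
   ('r, 's, 'n, 'y) bimodule_scheme \<Rightarrow> ('m \<times> 'n \<Rightarrow>\<^sub>0 int) set" where
  "tensor_subgroup R M N =
     generate (free_Abelian_group (carrier M \<times> carrier N)) (tensor_relations R M N)"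

definition tensor_group ::
  "('r, 'w) ring_scheme \<Rightarrow> ('r, 'm, 'x) right_module_scheme \<Rightarrow>
   ('r, 's, 'n, 'y) bimodule_scheme \<Rightarrow> ('m \<times> 'n \<Rightarrow>\<^sub>0 int) set ring" where
  "tensor_group R M N =
     (let Q = free_Abelian_group (carrier M \<times> carrier N) Mod tensor_subgroup R M N
      in \<lparr>carrier = carrier Q, monoid.mult = undefined, one = undefined,
          ring.zero = one Q, ring.add = monoid.mult Q\<rparr>)"

definition tensor_el ::
  "('r, 'w) ring_scheme \<Rightarrow> ('r, 'm, 'x) right_module_scheme \<Rightarrow>
   ('r, 's, 'n, 'y) bimodule_scheme \<Rightarrow> 'm \<Rightarrow> 'n \<Rightarrow> ('m \<times> 'n \<Rightarrow>\<^sub>0 int) set" where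
  "tensor_el R M N m n =
     tensor_subgroup R M N #>\<^bsub>free_Abelian_group (carrier M \<times> carrier N)\<^esub> frag_of (m, n)"

text \<open>
  The additive map \<open>M \<otimes>\<^sub>R N \<rightarrow> P\<close> with \<open>m \<otimes> n \<mapsto> \<beta> m n\<close>, computed on a representative of the
  coset. It is independent of the representative whenever \<open>\<beta>\<close> is biadditive and balanced,
  which is the only situation in which it is meant to be used.
\<close>

definition tensor_lift ::
  "('p, 'x) ring_scheme \<Rightarrow> ('m \<Rightarrow> 'n \<Rightarrow> 'p) \<Rightarrow> ('m \<times> 'n \<Rightarrow>\<^sub>0 int) set \<Rightarrow> 'p" where
  "tensor_lift P \<beta> t =
     (let c = (SOME c. c \<in> t)
      in \<Oplus>\<^bsub>P\<^esub>k\<in>Poly_Mapping.keys c. [Poly_Mapping.lookup c k] \<cdot>\<^bsub>P\<^esub> \<beta> (fst k) (snd k))"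

definition tensor ::
  "('r, 'w) ring_scheme \<Rightarrow> ('r, 'm, 'x) right_module_scheme \<Rightarrow>
   ('r, 's, 'n, 'y) bimodule_scheme \<Rightarrow> ('s, ('m \<times> 'n \<Rightarrow>\<^sub>0 int) set) right_module" where
  "tensor R M N =
     (let T = tensor_group R M N
      in \<lparr>carrier = carrier T, monoid.mult = monoid.mult T, one = one T, ring.zero = ring.zero T, ring.add = ring.add T,
          ract = (\<lambda>t s. tensor_lift T (\<lambda>m n. tensor_el R M N m (ract N n s)) t)\<rparr>)"

definition tensor_bimodule ::
  "('r, 'w) ring_scheme \<Rightarrow> ('q, 'r, 'm, 'x) bimodule_scheme \<Rightarrow>
   ('r, 's, 'n, 'y) bimodule_scheme \<Rightarrow> ('q, 's, ('m \<times> 'n \<Rightarrow>\<^sub>0 int) set) bimodule" where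
  "tensor_bimodule R M N =
     (let T = tensor R M N
      in \<lparr>carrier = carrier T, monoid.mult = monoid.mult T, one = one T, ring.zero = ring.zero T, ring.add = ring.add T,
          ract = ract T,
          lact = (\<lambda>q t. tensor_lift T (\<lambda>m n. tensor_el R M N (lact M q m) n) t)\<rparr>)"

text \<open>\<open>f \<otimes>\<^sub>R g\<close> with codomain \<open>M' \<otimes>\<^sub>R N'\<close>.\<close>

definition tensor_map ::
  "('r, 'w) ring_scheme \<Rightarrow> ('r, 'm2, 'x) right_module_scheme \<Rightarrow>
   ('r, 's, 'n2, 'y) bimodule_scheme \<Rightarrow> ('m \<Rightarrow> 'm2) \<Rightarrow> ('n \<Rightarrow> 'n2) \<Rightarrow>
   ('m \<times> 'n \<Rightarrow>\<^sub>0 int) set \<Rightarrow> ('m2 \<times> 'n2 \<Rightarrow>\<^sub>0 int) set" where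
  "tensor_map R M' N' f g =
     tensor_lift (tensor R M' N') (\<lambda>m n. tensor_el R M' N' (f m) (g n))"

text \<open>
  The canonical isomorphisms \<open>(M \<otimes> N) \<otimes> P \<cong> M \<otimes> (N \<otimes> P)\<close>, \<open>M \<otimes>\<^sub>A A \<cong> M\<close> and
  \<open>A \<otimes>\<^sub>A M \<cong> M\<close>, which are left implicit in the usual form of the comodule axioms.
\<close>

definition tensor_assoc ::
  "('r, 'w) ring_scheme \<Rightarrow> ('r, 'm, 'x) right_module_scheme \<Rightarrow>
   ('r, 'r, 'n, 'y) bimodule_scheme \<Rightarrow> ('r, 'r, 'p, 'z) bimodule_scheme \<Rightarrow>
   (('m \<times> 'n \<Rightarrow>\<^sub>0 int) set \<times> 'p \<Rightarrow>\<^sub>0 int) set \<Rightarrow>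
   ('m \<times> ('n \<times> 'p \<Rightarrow>\<^sub>0 int) set \<Rightarrow>\<^sub>0 int) set" where
  "tensor_assoc R M N P =
     (let NP = tensor_bimodule R N P; T = tensor R M NP
      in tensor_lift T
           (\<lambda>t p. tensor_lift T (\<lambda>m n. tensor_el R M NP m (tensor_el R N P n p)) t))"

definition right_unitor ::
  "('a, 'm, 'x) right_module_scheme \<Rightarrow> ('m \<times> 'a \<Rightarrow>\<^sub>0 int) set \<Rightarrow> 'm" where
  "right_unitor M = tensor_lift M (ract M)"

definition left_unitor ::
  "('a, 's, 'm, 'x) bimodule_scheme \<Rightarrow> ('a \<times> 'm \<Rightarrow>\<^sub>0 int) set \<Rightarrow> 'm" where
  "left_unitor M = tensor_lift M (lact M)"


section \<open>Group corings and their comodules\<close>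

record ('g, 'a, 'c) group_coring =
  ccomp :: "'g \<Rightarrow> ('a, 'a, 'c) bimodule"
  comult :: "'g \<Rightarrow> 'g \<Rightarrow> 'c \<Rightarrow> ('c \<times> 'c \<Rightarrow>\<^sub>0 int) set"
  counit :: "'c \<Rightarrow> 'a"

locale group_coring = G?: group G + A?: ring A
  for G :: "'g monoid" (structure) and A :: "'a ring" (structure)
    and C :: "('g, 'a, 'c) group_coring" +
  assumes comp_bimodule: "\<alpha> \<in> carrier G \<Longrightarrow> bimodule A A (ccomp C \<alpha>)"
    and comult_bilinear: "\<lbrakk>\<alpha> \<in> carrier G; \<beta> \<in> carrier G\<rbrakk> \<Longrightarrow>
      bilinear_map A A (ccomp C (\<alpha> \<otimes>\<^bsub>G\<^esub> \<beta>)) (tensor_bimodule A (ccomp C \<alpha>) (ccomp C \<beta>))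
        (comult C \<alpha> \<beta>)"
    and counit_bilinear: "bilinear_map A A (ccomp C \<one>\<^bsub>G\<^esub>) (ring_bimodule id A) (counit C)"
    and coassociative:
      "\<lbrakk>\<alpha> \<in> carrier G; \<beta> \<in> carrier G; \<gamma> \<in> carrier G;
        c \<in> carrier (ccomp C (\<alpha> \<otimes>\<^bsub>G\<^esub> \<beta> \<otimes>\<^bsub>G\<^esub> \<gamma>))\<rbrakk> \<Longrightarrow>
        tensor_assoc A (ccomp C \<alpha>) (ccomp C \<beta>) (ccomp C \<gamma>)
          (tensor_map A (tensor A (ccomp C \<alpha>) (ccomp C \<beta>)) (ccomp C \<gamma>) (comult C \<alpha> \<beta>) id
            (comult C (\<alpha> \<otimes>\<^bsub>G\<^esub> \<beta>) \<gamma> c)) =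
        tensor_map A (ccomp C \<alpha>) (tensor_bimodule A (ccomp C \<beta>) (ccomp C \<gamma>)) id (comult C \<beta> \<gamma>)
          (comult C \<alpha> (\<beta> \<otimes>\<^bsub>G\<^esub> \<gamma>) c)"
    and right_counit: "\<lbrakk>\<alpha> \<in> carrier G; c \<in> carrier (ccomp C \<alpha>)\<rbrakk> \<Longrightarrow>
      right_unitor (ccomp C \<alpha>)
        (tensor_map A (ccomp C \<alpha>) (ring_bimodule id A) id (counit C) (comult C \<alpha> \<one>\<^bsub>G\<^esub> c)) = c"
    and left_counit: "\<lbrakk>\<alpha> \<in> carrier G; c \<in> carrier (ccomp C \<alpha>)\<rbrakk> \<Longrightarrow>
      left_unitor (ccomp C \<alpha>)
        (tensor_map A (ring_bimodule id A) (ccomp C \<alpha>) (counit C) id (comult C \<one>\<^bsub>G\<^esub> \<alpha> c)) = c"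

definition grouplike_family ::
  "'g monoid \<Rightarrow> 'a ring \<Rightarrow> ('g, 'a, 'c) group_coring \<Rightarrow> ('g \<Rightarrow> 'c) \<Rightarrow> bool" where
  "grouplike_family G A C x \<longleftrightarrow>
     (\<forall>\<alpha>\<in>carrier G. x \<alpha> \<in> carrier (ccomp C \<alpha>)) \<and>
     (\<forall>\<alpha>\<in>carrier G. \<forall>\<beta>\<in>carrier G.
        comult C \<alpha> \<beta> (x (\<alpha> \<otimes>\<^bsub>G\<^esub> \<beta>)) = tensor_el A (ccomp C \<alpha>) (ccomp C \<beta>) (x \<alpha>) (x \<beta>)) \<and>
     counit C (x \<one>\<^bsub>G\<^esub>) = \<one>\<^bsub>A\<^esub>"

definition coinvariant_ring ::
  "'g monoid \<Rightarrow> 'a ring \<Rightarrow> ('g, 'a, 'c) group_coring \<Rightarrow> ('g \<Rightarrow> 'c) \<Rightarrow> 'a ring" where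
  "coinvariant_ring G A C x =
     A\<lparr>carrier := {a \<in> carrier A. \<forall>\<alpha>\<in>carrier G. lact (ccomp C \<alpha>) a (x \<alpha>) = ract (ccomp C \<alpha>) (x \<alpha>) a}\<rparr>"

record ('a, 'm, 'g, 'c) comodule = "('a, 'm) right_module" +
  coact :: "'g \<Rightarrow> 'm \<Rightarrow> ('m \<times> 'c \<Rightarrow>\<^sub>0 int) set"

locale comodule = group_coring G A C + right_module A M
  for G :: "'g monoid" (structure) and A :: "'a ring" (structure)
    and C :: "('g, 'a, 'c) group_coring" and M :: "('a, 'm, 'g, 'c) comodule" (structure) +
  assumes coact_linear: "\<alpha> \<in> carrier G \<Longrightarrow>
      right_linear A M (tensor A M (ccomp C \<alpha>)) (coact M \<alpha>)"
    and coact_coassociative: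
      "\<lbrakk>\<alpha> \<in> carrier G; \<beta> \<in> carrier G; m \<in> carrier M\<rbrakk> \<Longrightarrow>
        tensor_map A M (tensor_bimodule A (ccomp C \<alpha>) (ccomp C \<beta>)) id (comult C \<alpha> \<beta>)
          (coact M (\<alpha> \<otimes>\<^bsub>G\<^esub> \<beta>) m) =
        tensor_assoc A M (ccomp C \<alpha>) (ccomp C \<beta>)
          (tensor_map A (tensor A M (ccomp C \<alpha>)) (ccomp C \<beta>) (coact M \<alpha>) id (coact M \<beta> m))"
    and coact_counit: "m \<in> carrier M \<Longrightarrow>
      right_unitor M
        (tensor_map A M (ring_bimodule id A) id (counit C) (coact M \<one>\<^bsub>G\<^esub> m)) = m"

record ('a, 'm, 'g, 'c) gcomodule =
  gcomp :: "'g \<Rightarrow> ('a, 'm) right_module"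
  gcoact :: "'g \<Rightarrow> 'g \<Rightarrow> 'm \<Rightarrow> ('m \<times> 'c \<Rightarrow>\<^sub>0 int) set"

locale gcomodule = group_coring G A C
  for G :: "'g monoid" (structure) and A :: "'a ring" (structure)
    and C :: "('g, 'a, 'c) group_coring" and M :: "('a, 'm, 'g, 'c) gcomodule" +
  assumes gcomp_module: "\<alpha> \<in> carrier G \<Longrightarrow> right_module A (gcomp M \<alpha>)"
    and gcoact_linear: "\<lbrakk>\<alpha> \<in> carrier G; \<beta> \<in> carrier G\<rbrakk> \<Longrightarrow>
      right_linear A (gcomp M (\<alpha> \<otimes>\<^bsub>G\<^esub> \<beta>)) (tensor A (gcomp M \<alpha>) (ccomp C \<beta>)) (gcoact M \<alpha> \<beta>)"
    and gcoact_coassociative: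
      "\<lbrakk>\<alpha> \<in> carrier G; \<beta> \<in> carrier G; \<gamma> \<in> carrier G;
        m \<in> carrier (gcomp M (\<alpha> \<otimes>\<^bsub>G\<^esub> \<beta> \<otimes>\<^bsub>G\<^esub> \<gamma>))\<rbrakk> \<Longrightarrow>
        tensor_map A (gcomp M \<alpha>) (tensor_bimodule A (ccomp C \<beta>) (ccomp C \<gamma>)) id (comult C \<beta> \<gamma>)
          (gcoact M \<alpha> (\<beta> \<otimes>\<^bsub>G\<^esub> \<gamma>) m) =
        tensor_assoc A (gcomp M \<alpha>) (ccomp C \<beta>) (ccomp C \<gamma>)
          (tensor_map A (tensor A (gcomp M \<alpha>) (ccomp C \<beta>)) (ccomp C \<gamma>) (gcoact M \<alpha> \<beta>) id
            (gcoact M (\<alpha> \<otimes>\<^bsub>G\<^esub> \<beta>) \<gamma> m))"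
    and gcoact_counit: "\<lbrakk>\<alpha> \<in> carrier G; m \<in> carrier (gcomp M \<alpha>)\<rbrakk> \<Longrightarrow>
      right_unitor (gcomp M \<alpha>)
        (tensor_map A (gcomp M \<alpha>) (ring_bimodule id A) id (counit C) (gcoact M \<alpha> \<one>\<^bsub>G\<^esub> m)) = m"


section \<open>The categories\<close>

text \<open>Composition takes the source object as an argument, since it restricts to its carrier.\<close>

record ('o, 'f) category =
  Ob :: "'o set"
  Hom :: "'o \<Rightarrow> 'o \<Rightarrow> 'f set"
  Idm :: "'o \<Rightarrow> 'f"
  Cmp :: "'o \<Rightarrow> 'f \<Rightarrow> 'f \<Rightarrow> 'f"

locale category =
  fixes \<C> :: "('o, 'f) category"
  assumes Idm_in_Hom: "U \<in> Ob \<C> \<Longrightarrow> Idm \<C> U \<in> Hom \<C> U U"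
    and Cmp_in_Hom: "\<lbrakk>U \<in> Ob \<C>; V \<in> Ob \<C>; W \<in> Ob \<C>; f \<in> Hom \<C> U V; g \<in> Hom \<C> V W\<rbrakk>
      \<Longrightarrow> Cmp \<C> U g f \<in> Hom \<C> U W"
    and Cmp_Idm_right: "\<lbrakk>U \<in> Ob \<C>; V \<in> Ob \<C>; f \<in> Hom \<C> U V\<rbrakk> \<Longrightarrow> Cmp \<C> U f (Idm \<C> U) = f"
    and Cmp_Idm_left: "\<lbrakk>U \<in> Ob \<C>; V \<in> Ob \<C>; f \<in> Hom \<C> U V\<rbrakk> \<Longrightarrow> Cmp \<C> U (Idm \<C> V) f = f"
    and Cmp_assoc: "\<lbrakk>Z \<in> Ob \<C>; U \<in> Ob \<C>; V \<in> Ob \<C>; W \<in> Ob \<C>;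
        f \<in> Hom \<C> Z U; g \<in> Hom \<C> U V; h \<in> Hom \<C> V W\<rbrakk>
      \<Longrightarrow> Cmp \<C> Z (Cmp \<C> U h g) f = Cmp \<C> Z h (Cmp \<C> Z g f)"

text \<open>The action on arrows takes source and target as its first two arguments.\<close>

record ('o, 'f, 'p, 'h) cat_functor =
  omap :: "'o \<Rightarrow> 'p"
  amap :: "'o \<Rightarrow> 'o \<Rightarrow> 'f \<Rightarrow> 'h"

locale cat_functor = \<C>: category \<C> + \<D>: category \<D>
  for \<C> :: "('o, 'f) category" and \<D> :: "('p, 'h) category"
    and F :: "('o, 'f, 'p, 'h) cat_functor" +
  assumes omap_Ob: "U \<in> Ob \<C> \<Longrightarrow> omap F U \<in> Ob \<D>"
    and amap_Hom: "\<lbrakk>U \<in> Ob \<C>; V \<in> Ob \<C>; f \<in> Hom \<C> U V\<rbrakk>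
      \<Longrightarrow> amap F U V f \<in> Hom \<D> (omap F U) (omap F V)"
    and amap_Idm: "U \<in> Ob \<C> \<Longrightarrow> amap F U U (Idm \<C> U) = Idm \<D> (omap F U)"
    and amap_Cmp: "\<lbrakk>U \<in> Ob \<C>; V \<in> Ob \<C>; W \<in> Ob \<C>; f \<in> Hom \<C> U V; g \<in> Hom \<C> V W\<rbrakk>
      \<Longrightarrow> amap F U W (Cmp \<C> U g f) = Cmp \<D> (omap F U) (amap F V W g) (amap F U V f)"

definition comp_functor ::
  "('p, 'h, 'q, 'k) cat_functor \<Rightarrow> ('o, 'f, 'p, 'h) cat_functor \<Rightarrow> ('o, 'f, 'q, 'k) cat_functor"
  where
  "comp_functor K H =
     \<lparr>omap = omap K \<circ> omap H,
      amap = (\<lambda>U V f. amap K (omap H U) (omap H V) (amap H U V f))\<rparr>"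

text \<open>
  Hom-sets consist of extensional functions, so that equality in HOL is equality of morphisms.
  A category has all its objects over one carrier type, whereas tensor products and products over
  the group change that type. Hom-sets and compositions are therefore polymorphic in the carrier
  types of source and target, so that morphisms from \<open>F(N)\<close> to \<open>M\<close> and from \<open>N\<close> to \<open>G(M)\<close> make
  sense for \<open>N\<close> and \<open>M\<close> over arbitrary types.
\<close>

definition rmod_hom ::
  "('s, 'w) ring_scheme \<Rightarrow> ('s, 'm, 'x) right_module_scheme \<Rightarrow>
   ('s, 'n, 'y) right_module_scheme \<Rightarrow> ('m \<Rightarrow> 'n) set" where
  "rmod_hom S M N = {f \<in> extensional (carrier M). right_linear S M N f}"

definition rmod_cat :: "'s ring \<Rightarrow> (('s, 'm) right_module, 'm \<Rightarrow> 'm) category" where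
  "rmod_cat S =
     \<lparr>Ob = {M. right_module S M}, Hom = rmod_hom S,
      Idm = (\<lambda>M. \<lambda>m\<in>carrier M. m), Cmp = (\<lambda>M. compose (carrier M))\<rparr>"

definition comod_hom ::
  "'g monoid \<Rightarrow> 'a ring \<Rightarrow> ('g, 'a, 'c) group_coring \<Rightarrow>
   ('a, 'm, 'g, 'c) comodule \<Rightarrow> ('a, 'n, 'g, 'c) comodule \<Rightarrow> ('m \<Rightarrow> 'n) set" where
  "comod_hom G A C M N =
     {f \<in> rmod_hom A M N. \<forall>\<alpha>\<in>carrier G. \<forall>m\<in>carrier M.
        tensor_map A N (ccomp C \<alpha>) f id (coact M \<alpha> m) = coact N \<alpha> (f m)}"

definition comod_cat ::
  "'g monoid \<Rightarrow> 'a ring \<Rightarrow> ('g, 'a, 'c) group_coring \<Rightarrow>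
   (('a, 'm, 'g, 'c) comodule, 'm \<Rightarrow> 'm) category" where
  "comod_cat G A C =
     \<lparr>Ob = {M. comodule G A C M}, Hom = comod_hom G A C,
      Idm = (\<lambda>M. \<lambda>m\<in>carrier M. m), Cmp = (\<lambda>M. compose (carrier M))\<rparr>"

definition gcomod_hom ::
  "'g monoid \<Rightarrow> 'a ring \<Rightarrow> ('g, 'a, 'c) group_coring \<Rightarrow>
   ('a, 'm, 'g, 'c) gcomodule \<Rightarrow> ('a, 'n, 'g, 'c) gcomodule \<Rightarrow> ('g \<Rightarrow> 'm \<Rightarrow> 'n) set" where
  "gcomod_hom G A C M N =
     {f \<in> (\<Pi>\<^sub>E \<alpha>\<in>carrier G. rmod_hom A (gcomp M \<alpha>) (gcomp N \<alpha>)).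
        \<forall>\<alpha>\<in>carrier G. \<forall>\<beta>\<in>carrier G. \<forall>m\<in>carrier (gcomp M (\<alpha> \<otimes>\<^bsub>G\<^esub> \<beta>)).
          tensor_map A (gcomp N \<alpha>) (ccomp C \<beta>) (f \<alpha>) id (gcoact M \<alpha> \<beta> m) =
          gcoact N \<alpha> \<beta> (f (\<alpha> \<otimes>\<^bsub>G\<^esub> \<beta>) m)}"

definition gcomod_compose ::
  "'g monoid \<Rightarrow> ('a, 'm, 'g, 'c) gcomodule \<Rightarrow>
   ('g \<Rightarrow> 'n \<Rightarrow> 'p) \<Rightarrow> ('g \<Rightarrow> 'm \<Rightarrow> 'n) \<Rightarrow> 'g \<Rightarrow> 'm \<Rightarrow> 'p" where
  "gcomod_compose G M g f = (\<lambda>\<alpha>\<in>carrier G. compose (carrier (gcomp M \<alpha>)) (g \<alpha>) (f \<alpha>))"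

definition gcomod_cat ::
  "'g monoid \<Rightarrow> 'a ring \<Rightarrow> ('g, 'a, 'c) group_coring \<Rightarrow>
   (('a, 'm, 'g, 'c) gcomodule, 'g \<Rightarrow> 'm \<Rightarrow> 'm) category" where
  "gcomod_cat G A C =
     \<lparr>Ob = {M. gcomodule G A C M}, Hom = gcomod_hom G A C,
      Idm = (\<lambda>M. \<lambda>\<alpha>\<in>carrier G. \<lambda>m\<in>carrier (gcomp M \<alpha>). m), Cmp = gcomod_compose G\<rparr>"


section \<open>The functors\<close>

text \<open>Throughout, \<open>i\<close> is the given ring morphism from \<open>B\<close> to the coinvariants.\<close>

definition F6_obj ::
  "'a ring \<Rightarrow> ('g, 'a, 'c) group_coring \<Rightarrow> ('g \<Rightarrow> 'c) \<Rightarrow> 'b ring \<Rightarrow> ('b \<Rightarrow> 'a) \<Rightarrow>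
   ('b, 'n) right_module \<Rightarrow> ('a, ('n \<times> 'a \<Rightarrow>\<^sub>0 int) set, 'g, 'c) comodule" where
  "F6_obj A C x B i N =
     (let A' = ring_bimodule i A; T = tensor B N A'
      in \<lparr>carrier = carrier T, monoid.mult = monoid.mult T, one = one T, ring.zero = ring.zero T, ring.add = ring.add T,
          ract = ract T,
          coact = (\<lambda>\<alpha>. tensor_lift (tensor A T (ccomp C \<alpha>))
            (\<lambda>n a. tensor_el A T (ccomp C \<alpha>)
               (tensor_el B N A' n \<one>\<^bsub>A\<^esub>) (ract (ccomp C \<alpha>) (x \<alpha>) a)))\<rparr>)"

definition F6 ::
  "'a ring \<Rightarrow> ('g, 'a, 'c) group_coring \<Rightarrow> ('g \<Rightarrow> 'c) \<Rightarrow> 'b ring \<Rightarrow> ('b \<Rightarrow> 'a) \<Rightarrow>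
   (('b, 'n) right_module, 'n \<Rightarrow> 'n,
    ('a, ('n \<times> 'a \<Rightarrow>\<^sub>0 int) set, 'g, 'c) comodule,
    ('n \<times> 'a \<Rightarrow>\<^sub>0 int) set \<Rightarrow> ('n \<times> 'a \<Rightarrow>\<^sub>0 int) set) cat_functor" where
  "F6 A C x B i =
     \<lparr>omap = F6_obj A C x B i,
      amap = (\<lambda>N N' f. restrict (tensor_map B N' (ring_bimodule i A) f id)
                                (carrier (F6_obj A C x B i N)))\<rparr>"

text \<open>The copies \<open>\<mu>\<^sub>\<alpha>(M)\<close> of \<open>M\<close> are told apart by their index in the family only.\<close>

definition G1 ::
  "'g monoid \<Rightarrow>
   (('a, 'm, 'g, 'c) comodule, 'm \<Rightarrow> 'm,
    ('a, 'm, 'g, 'c) gcomodule, 'g \<Rightarrow> 'm \<Rightarrow> 'm) cat_functor" where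
  "G1 G =
     \<lparr>omap = (\<lambda>M. \<lparr>gcomp = (\<lambda>\<alpha>. right_module.truncate M), gcoact = (\<lambda>\<alpha> \<beta>. coact M \<beta>)\<rparr>),
      amap = (\<lambda>M N f. \<lambda>\<alpha>\<in>carrier G. f)\<rparr>"

definition F7 ::
  "'g monoid \<Rightarrow> 'a ring \<Rightarrow> ('g, 'a, 'c) group_coring \<Rightarrow> ('g \<Rightarrow> 'c) \<Rightarrow> 'b ring \<Rightarrow> ('b \<Rightarrow> 'a) \<Rightarrow>
   (('b, 'n) right_module, 'n \<Rightarrow> 'n,
    ('a, ('n \<times> 'a \<Rightarrow>\<^sub>0 int) set, 'g, 'c) gcomodule,
    'g \<Rightarrow> ('n \<times> 'a \<Rightarrow>\<^sub>0 int) set \<Rightarrow> ('n \<times> 'a \<Rightarrow>\<^sub>0 int) set) cat_functor" where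
  "F7 G A C x B i = comp_functor (G1 G) (F6 A C x B i)"

definition G7_obj ::
  "'g monoid \<Rightarrow> 'a ring \<Rightarrow> ('g, 'a, 'c) group_coring \<Rightarrow> ('g \<Rightarrow> 'c) \<Rightarrow> ('b \<Rightarrow> 'a) \<Rightarrow>
   ('a, 'm, 'g, 'c) gcomodule \<Rightarrow> ('b, 'g \<Rightarrow> 'm) right_module" where
  "G7_obj G A C x i M =
     \<lparr>carrier = {m \<in> (\<Pi>\<^sub>E \<alpha>\<in>carrier G. carrier (gcomp M \<alpha>)).
        \<forall>\<alpha>\<in>carrier G. \<forall>\<beta>\<in>carrier G.
          gcoact M \<alpha> \<beta> (m (\<alpha> \<otimes>\<^bsub>G\<^esub> \<beta>)) = tensor_el A (gcomp M \<alpha>) (ccomp C \<beta>) (m \<alpha>) (x \<beta>)},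
      monoid.mult = undefined, one = undefined,
      ring.zero = (\<lambda>\<alpha>\<in>carrier G. \<zero>\<^bsub>gcomp M \<alpha>\<^esub>),
      ring.add = (\<lambda>m n. \<lambda>\<alpha>\<in>carrier G. m \<alpha> \<oplus>\<^bsub>gcomp M \<alpha>\<^esub> n \<alpha>),
      ract = (\<lambda>m b. \<lambda>\<alpha>\<in>carrier G. ract (gcomp M \<alpha>) (m \<alpha>) (i b))\<rparr>"

definition G7 ::
  "'g monoid \<Rightarrow> 'a ring \<Rightarrow> ('g, 'a, 'c) group_coring \<Rightarrow> ('g \<Rightarrow> 'c) \<Rightarrow> ('b \<Rightarrow> 'a) \<Rightarrow>
   (('a, 'm, 'g, 'c) gcomodule, 'g \<Rightarrow> 'm \<Rightarrow> 'm,
    ('b, 'g \<Rightarrow> 'm) right_module, ('g \<Rightarrow> 'm) \<Rightarrow> 'g \<Rightarrow> 'm) cat_functor" where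
  "G7 G A C x i =
     \<lparr>omap = G7_obj G A C x i,
      amap = (\<lambda>M M' f. \<lambda>m\<in>carrier (G7_obj G A C x i M). \<lambda>\<alpha>\<in>carrier G. f \<alpha> (m \<alpha>))\<rparr>"

end

theory Submission
  imports Defs
begin

text \<open>
  The adjunction rests on one observation. The right \<open>A\<close>-module \<open>N \<otimes>\<^sub>B A\<close> is generated by the elements
  \<open>n \<otimes> 1\<close>, so a morphism \<open>h\<close> from \<open>F\<^sub>7(N)\<close> to \<open>M\<close> is known as soon as all \<open>h\<^sub>\<alpha>(n \<otimes> 1)\<close> are
  known. Since the coaction sends \<open>n \<otimes> 1\<close> to \<open>(n \<otimes> 1) \<otimes> x\<^sub>\<beta>\<close>, compatibility of \<open>h\<close> with the coactions,
  read at \<open>n \<otimes> 1\<close>, says exactly that the family \<open>(h\<^sub>\<alpha>(n \<otimes> 1))\<^sub>\<alpha>\<close> is coinvariant; and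
  \<open>nb \<otimes> 1 = (n \<otimes> 1) i(b)\<close> turns \<open>A\<close>-linearity of \<open>h\<close> into \<open>B\<close>-linearity in \<open>n\<close>. Conversely, a
  \<open>B\<close>-linear \<open>k\<close> into the coinvariants extends by \<open>h\<^sub>\<alpha>(n \<otimes> a) = k(n)\<^sub>\<alpha> a\<close>. This is the bijection
  \<open>adjunct\<close>; naturality in both variables is immediate because both sides are evaluated at \<open>n \<otimes> 1\<close>.

  That the image of \<open>B\<close> commutes with the grouplike family (\<open>x_central\<close>) enters twice: it makes the
  coaction on \<open>N \<otimes>\<^sub>B A\<close> respect the relation \<open>nb \<otimes> a = n \<otimes> ba\<close> (\<open>F6_coact_linear\<close>), and it makes the
  coinvariants stable under \<open>B\<close> (\<open>right_module_G7\<close>). The comodule axioms for \<open>N \<otimes>\<^sub>B A\<close> are the two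
  grouplike identities, \<open>comult_x\<close> for coassociativity and \<open>counit_x\<close> for the counit.

  All of this takes place in concrete tensor products, that is, quotients of free abelian groups, on
  which maps are given by evaluation at a chosen representative. Two facts replace computations with
  representatives: a balanced map induces a well-defined additive map (\<open>tensor_lift_add_hom\<close>,
  \<open>tensor_lift_el\<close>), and additive maps that agree on the elements \<open>m \<otimes> n\<close> are equal
  (\<open>tensor_hom_eqI\<close>). Every identity between maps on a tensor product, including coassociativity, is
  then checked on generators only; \<open>induced_eqI\<close> is the form of this principle for \<open>N \<otimes>\<^sub>B A\<close>.
\<close>

section \<open>Additive and linear maps\<close>

abbreviation add_hom :: "('m, 'x) ring_scheme \<Rightarrow> ('p, 'y) ring_scheme \<Rightarrow> ('m \<Rightarrow> 'p) set" where
  "add_hom M P \<equiv> hom (add_monoid M) (add_monoid P)"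

lemma add_hom_closed: "\<lbrakk>f \<in> add_hom M P; a \<in> carrier M\<rbrakk> \<Longrightarrow> f a \<in> carrier P"
  by (auto simp: hom_def)

lemma add_hom_add:
  "\<lbrakk>f \<in> add_hom M P; a \<in> carrier M; b \<in> carrier M\<rbrakk> \<Longrightarrow> f (a \<oplus>\<^bsub>M\<^esub> b) = f a \<oplus>\<^bsub>P\<^esub> f b"
  by (auto simp: hom_def)

lemma add_homI:
  assumes "\<And>a. a \<in> carrier M \<Longrightarrow> f a \<in> carrier P"
    and "\<And>a b. \<lbrakk>a \<in> carrier M; b \<in> carrier M\<rbrakk> \<Longrightarrow> f (a \<oplus>\<^bsub>M\<^esub> b) = f a \<oplus>\<^bsub>P\<^esub> f b"
  shows "f \<in> add_hom M P"
  using assms by (auto simp: hom_def)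

lemma add_hom_comp: "\<lbrakk>f \<in> add_hom M P; g \<in> add_hom P Q\<rbrakk> \<Longrightarrow> (\<lambda>a. g (f a)) \<in> add_hom M Q"
  by (auto simp: hom_def Pi_def)

lemma add_hom_sum:
  assumes "abelian_group P" "f \<in> add_hom M P" "g \<in> add_hom M P"
  shows "(\<lambda>a. f a \<oplus>\<^bsub>P\<^esub> g a) \<in> add_hom M P"
proof -
  interpret abelian_group P by fact
  show ?thesis
    by (rule add_homI) (use assms in \<open>simp_all add: add_hom_closed add_hom_add a_ac\<close>)
qed

lemma add_hom_group_hom:
  assumes "abelian_group M" "abelian_group P" "f \<in> add_hom M P"
  shows "group_hom (add_monoid M) (add_monoid P) f"
  using assms by (simp add: group_hom_def group_hom_axioms_def abelian_group.a_group)

lemma add_hom_zero: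
  assumes "abelian_group M" "abelian_group P" "f \<in> add_hom M P"
  shows "f \<zero>\<^bsub>M\<^esub> = \<zero>\<^bsub>P\<^esub>"
  using group_hom.hom_one[OF add_hom_group_hom[OF assms]] by simp

lemma add_hom_neg:
  assumes "abelian_group M" "abelian_group P" "f \<in> add_hom M P" "a \<in> carrier M"
  shows "f (\<ominus>\<^bsub>M\<^esub> a) = \<ominus>\<^bsub>P\<^esub> f a"
  using group_hom.hom_inv[OF add_hom_group_hom[OF assms(1-3)]] assms(4) by (simp add: a_inv_def)

lemma add_hom_diff:
  assumes "abelian_group M" "abelian_group P" "f \<in> add_hom M P" "a \<in> carrier M" "b \<in> carrier M"
  shows "f (a \<ominus>\<^bsub>M\<^esub> b) = f a \<ominus>\<^bsub>P\<^esub> f b"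
  using assms by (simp add: a_minus_def add_hom_add add_hom_neg abelian_group.a_inv_closed)

lemma bimodule_right_module: "bimodule R S N \<Longrightarrow> right_module S N"
  by (rule bimodule.axioms(2))

lemma right_module_abelian_group: "right_module S M \<Longrightarrow> abelian_group M"
  by (rule right_module.axioms(2))

lemma right_linear_add_hom: "right_linear S M N f \<Longrightarrow> f \<in> add_hom M N"
  by (simp add: right_linear_def)

lemma right_linear_ract:
  "\<lbrakk>right_linear S M N f; m \<in> carrier M; s \<in> carrier S\<rbrakk> \<Longrightarrow> f (ract M m s) = ract N (f m) s"
  by (simp add: right_linear_def)

lemma bilinear_map_right_linear: "bilinear_map R S M N f \<Longrightarrow> right_linear S M N f"
  by (simp add: bilinear_map_def)

lemma bilinear_map_lact:
  "\<lbrakk>bilinear_map R S M N f; r \<in> carrier R; m \<in> carrier M\<rbrakk> \<Longrightarrow> f (lact M r m) = lact N r (f m)"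
  by (simp add: bilinear_map_def)

section \<open>The universal property of the tensor product\<close>

text \<open>
  The lift is a finite sum of integer multiples, so it sees only the additive group of its target. This
  allows the target record to be exchanged for another one with the same additive group.
\<close>

lemma tensor_lift_cong:
  assumes "carrier P = carrier P'" "ring.add P = ring.add P'" "ring.zero P = ring.zero P'"
  shows "tensor_lift P = tensor_lift P'"
proof -
  have inv: "\<ominus>\<^bsub>P\<^esub> a = \<ominus>\<^bsub>P'\<^esub> a" for a
    by (simp add: a_inv_def m_inv_def assms)
  have nat: "[n] \<cdot>\<^bsub>P\<^esub> a = [n] \<cdot>\<^bsub>P'\<^esub> a" for n :: nat and a
    by (simp add: add_pow_def nat_pow_def assms)
  have pow: "[k] \<cdot>\<^bsub>P\<^esub> a = [k] \<cdot>\<^bsub>P'\<^esub> a" for k :: int and a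
    by (cases "k < 0") (simp_all add: add_pow_int_ge add_pow_int_lt inv nat)
  show ?thesis
    by (simp add: tensor_lift_def fun_eq_iff pow finsum_def finprod_def assms)
qed

definition balanced_map ::
  "('r, 'w) ring_scheme \<Rightarrow> ('r, 'm, 'x) right_module_scheme \<Rightarrow>
   ('r, 's, 'n, 'y) bimodule_scheme \<Rightarrow> ('p, 'z) ring_scheme \<Rightarrow> ('m \<Rightarrow> 'n \<Rightarrow> 'p) \<Rightarrow> bool" where
  "balanced_map R M N P \<beta> \<longleftrightarrow>
     (\<forall>n\<in>carrier N. (\<lambda>m. \<beta> m n) \<in> add_hom M P) \<and>
     (\<forall>m\<in>carrier M. \<beta> m \<in> add_hom N P) \<and>
     (\<forall>m\<in>carrier M. \<forall>r\<in>carrier R. \<forall>n\<in>carrier N. \<beta> (ract M m r) n = \<beta> m (lact N r n))"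

lemma balanced_mapI:
  assumes "\<And>n. n \<in> carrier N \<Longrightarrow> (\<lambda>m. \<beta> m n) \<in> add_hom M P"
    and "\<And>m. m \<in> carrier M \<Longrightarrow> \<beta> m \<in> add_hom N P"
    and "\<And>m r n. \<lbrakk>m \<in> carrier M; r \<in> carrier R; n \<in> carrier N\<rbrakk>
      \<Longrightarrow> \<beta> (ract M m r) n = \<beta> m (lact N r n)"
  shows "balanced_map R M N P \<beta>"
  using assms by (simp add: balanced_map_def)

locale tensor_factors =
  fixes R :: "('r, 'w) ring_scheme" and S :: "('s, 'v) ring_scheme"
    and M :: "('r, 'm, 'x) right_module_scheme" and N :: "('r, 's, 'n, 'y) bimodule_scheme"
  assumes left_factor: "right_module R M" and right_factor: "bimodule R S N"
begin

interpretation M: right_module R M by (rule left_factor)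
interpretation N: bimodule R S N by (rule right_factor)

abbreviation "F \<equiv> free_Abelian_group (carrier M \<times> carrier N)"
abbreviation "K \<equiv> tensor_subgroup R M N"
abbreviation "T \<equiv> tensor R M N"
abbreviation "el \<equiv> tensor_el R M N"

lemma tensor_relations_subset: "tensor_relations R M N \<subseteq> carrier F"
proof -
  have *: "Poly_Mapping.keys (frag_of u - frag_of v - frag_of w) \<subseteq> {u, v, w}"
    for u v w :: "'m \<times> 'n"
    by (rule order_trans[OF keys_diff]) (use keys_diff[of "frag_of u" "frag_of v"] in auto)
  have **: "Poly_Mapping.keys (frag_of u - frag_of v) \<subseteq> {u, v}" for u v :: "'m \<times> 'n"
    by (rule order_trans[OF keys_diff]) auto
  show ?thesis
    unfolding tensor_relations_def
    using * ** by (auto simp: M.ract_closed N.lact_closed dest!: set_mp[OF *] set_mp[OF **])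
qed

lemma tensor_subgroup_normal: "K \<lhd> F"
  unfolding tensor_subgroup_def
  by (intro comm_group.normal_iff_subgroup[THEN iffD2] abelian_free_Abelian_group
      group.generate_is_subgroup group_free_Abelian_group tensor_relations_subset)

lemma carrier_tensor: "carrier T = (\<lambda>c. K #>\<^bsub>F\<^esub> c) ` carrier F"
  by (auto simp: tensor_def tensor_group_def Let_def FactGroup_def RCOSETS_def)

lemma add_coset:
  "\<lbrakk>c \<in> carrier F; d \<in> carrier F\<rbrakk> \<Longrightarrow> (K #>\<^bsub>F\<^esub> c) \<oplus>\<^bsub>T\<^esub> (K #>\<^bsub>F\<^esub> d) = K #>\<^bsub>F\<^esub> (c + d)"
  using normal.rcos_sum[OF tensor_subgroup_normal, of c d]
  by (simp add: tensor_def tensor_group_def Let_def FactGroup_def)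

lemma zero_tensor: "\<zero>\<^bsub>T\<^esub> = K #>\<^bsub>F\<^esub> 0"
  using group.coset_mult_one[OF group_free_Abelian_group, of K "carrier M \<times> carrier N"]
    subgroup.subset[OF normal.axioms(1)[OF tensor_subgroup_normal]]
  by (simp add: tensor_def tensor_group_def Let_def FactGroup_def)

text \<open>
  The additive monoid of the record \<open>tensor R M N\<close> carries a further field, so it is not literally the
  quotient group; the axioms are therefore read off from representatives.
\<close>

lemma tensor_abelian_group: "abelian_group T"
proof (rule abelian_groupI)
  have add_closed: "c + d \<in> carrier F" if "c \<in> carrier F" "d \<in> carrier F" for c d
    using that keys_add[of c d] by auto
  fix t assume t: "t \<in> carrier T"
  show "\<exists>u\<in>carrier T. u \<oplus>\<^bsub>T\<^esub> t = \<zero>\<^bsub>T\<^esub>"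
  proof -
    obtain c where c: "c \<in> carrier F" "t = K #>\<^bsub>F\<^esub> c" using t by (auto simp: carrier_tensor)
    then have "- c \<in> carrier F" by simp
    then show ?thesis using c add_coset[of "- c" c] by (auto simp: carrier_tensor zero_tensor)
  qed
  show "\<zero>\<^bsub>T\<^esub> \<oplus>\<^bsub>T\<^esub> t = t"
    using t add_coset[of 0] unfolding zero_tensor carrier_tensor by auto
  fix u assume u: "u \<in> carrier T"
  show "t \<oplus>\<^bsub>T\<^esub> u \<in> carrier T"
    using t u add_closed unfolding carrier_tensor by (auto simp del: carrier_free_Abelian_group_iff simp: add_coset)
  show "t \<oplus>\<^bsub>T\<^esub> u = u \<oplus>\<^bsub>T\<^esub> t"
    using t u unfolding carrier_tensor
    by (auto simp del: carrier_free_Abelian_group_iff simp: add_coset add.commute)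
  fix v assume v: "v \<in> carrier T"
  show "t \<oplus>\<^bsub>T\<^esub> u \<oplus>\<^bsub>T\<^esub> v = t \<oplus>\<^bsub>T\<^esub> (u \<oplus>\<^bsub>T\<^esub> v)"
    using t u v add_closed unfolding carrier_tensor
    by (auto simp del: carrier_free_Abelian_group_iff simp: add_coset add.assoc)
next
  show "\<zero>\<^bsub>T\<^esub> \<in> carrier T"
    by (auto simp: carrier_tensor zero_tensor)
qed

lemma diff_coset:
  assumes "c \<in> carrier F" "d \<in> carrier F"
  shows "K #>\<^bsub>F\<^esub> (c - d) = (K #>\<^bsub>F\<^esub> c) \<ominus>\<^bsub>T\<^esub> (K #>\<^bsub>F\<^esub> d)"
proof -
  interpret T: abelian_group T by (rule tensor_abelian_group)
  have "c - d \<in> carrier F" using assms keys_diff[of c d] by auto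
  then have "(K #>\<^bsub>F\<^esub> c) = (K #>\<^bsub>F\<^esub> (c - d)) \<oplus>\<^bsub>T\<^esub> (K #>\<^bsub>F\<^esub> d)"
    using assms add_coset[of "c - d" d] by simp
  moreover have "K #>\<^bsub>F\<^esub> (c - d) \<in> carrier T" "K #>\<^bsub>F\<^esub> d \<in> carrier T"
    using \<open>c - d \<in> carrier F\<close> assms by (auto simp: carrier_tensor)
  ultimately show ?thesis
    by (simp add: T.minus_eq T.a_assoc T.r_neg)
qed

lemma relation_coset:
  assumes "c - d \<in> tensor_relations R M N" "c \<in> carrier F" "d \<in> carrier F"
  shows "K #>\<^bsub>F\<^esub> c = K #>\<^bsub>F\<^esub> d"
proof -
  interpret K: normal K F by (rule tensor_subgroup_normal)
  have "c - d \<in> K"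
    unfolding tensor_subgroup_def using assms(1) by (rule generate.incl)
  then have "c \<in> K #>\<^bsub>F\<^esub> d"
    unfolding r_coset_def by force
  then show ?thesis
    using group.repr_independence[OF group_free_Abelian_group _ assms(3) K.subgroup_axioms] by simp
qed

lemma el_closed: "\<lbrakk>m \<in> carrier M; n \<in> carrier N\<rbrakk> \<Longrightarrow> el m n \<in> carrier T"
  unfolding carrier_tensor tensor_el_def by (rule imageI) simp

lemma el_add_left:
  assumes "m \<in> carrier M" "m' \<in> carrier M" "n \<in> carrier N"
  shows "el (m \<oplus>\<^bsub>M\<^esub> m') n = el m n \<oplus>\<^bsub>T\<^esub> el m' n"
proof -
  have "frag_of (m \<oplus>\<^bsub>M\<^esub> m', n) - (frag_of (m, n) + frag_of (m', n)) \<in> tensor_relations R M N"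
    using assms unfolding tensor_relations_def diff_add_eq_diff_diff_swap by (auto simp: algebra_simps)
  then show ?thesis
    unfolding tensor_el_def using assms
    by (subst relation_coset[of _ "frag_of (m, n) + frag_of (m', n)"])
      (auto simp: add_coset dest: set_mp[OF keys_add])
qed

lemma el_add_right:
  assumes "m \<in> carrier M" "n \<in> carrier N" "n' \<in> carrier N"
  shows "el m (n \<oplus>\<^bsub>N\<^esub> n') = el m n \<oplus>\<^bsub>T\<^esub> el m n'"
proof -
  have "frag_of (m, n \<oplus>\<^bsub>N\<^esub> n') - (frag_of (m, n) + frag_of (m, n')) \<in> tensor_relations R M N"
    using assms unfolding tensor_relations_def by (force simp: algebra_simps)
  then show ?thesis
    unfolding tensor_el_def using assms
    by (subst relation_coset[of _ "frag_of (m, n) + frag_of (m, n')"])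
      (auto simp: add_coset dest: set_mp[OF keys_add])
qed

lemma el_balanced:
  assumes "m \<in> carrier M" "r \<in> carrier R" "n \<in> carrier N"
  shows "el (ract M m r) n = el m (lact N r n)"
proof -
  have "frag_of (ract M m r, n) - frag_of (m, lact N r n) \<in> tensor_relations R M N"
    using assms unfolding tensor_relations_def by force
  then show ?thesis
    unfolding tensor_el_def using assms
    by (intro relation_coset) (auto simp: M.ract_closed N.lact_closed)
qed

lemma el_balanced_map: "balanced_map R M N T el"
  by (intro balanced_mapI add_homI) (simp_all add: el_closed el_add_left el_add_right el_balanced)

text \<open>
  Differences rather than sums appear as the closure condition: they also produce negatives, hence all
  integer combinations of the generators.
\<close>

lemma tensor_induct:
  assumes "t \<in> carrier T"
    and "P \<zero>\<^bsub>T\<^esub>"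
    and diff: "\<And>t u. \<lbrakk>t \<in> carrier T; u \<in> carrier T; P t; P u\<rbrakk> \<Longrightarrow> P (t \<ominus>\<^bsub>T\<^esub> u)"
    and el: "\<And>m n. \<lbrakk>m \<in> carrier M; n \<in> carrier N\<rbrakk> \<Longrightarrow> P (el m n)"
  shows "P t"
proof -
  interpret K: normal K F by (rule tensor_subgroup_normal)
  obtain c where c: "Poly_Mapping.keys c \<subseteq> carrier M \<times> carrier N" "t = K #>\<^bsub>F\<^esub> c"
    using assms(1) by (auto simp: carrier_tensor)
  have "P (K #>\<^bsub>F\<^esub> c)"
    using c(1)
  proof (induction c rule: free_Abelian_group_induct[consumes 1])
    case 1
    have "K #>\<^bsub>F\<^esub> 0 = \<zero>\<^bsub>T\<^esub>"
      by (simp add: zero_tensor)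
    then show ?case using assms(2) by simp
  next
    case (2 c d)
    then show ?case
      by (simp add: diff_coset diff carrier_tensor)
  next
    case (3 a)
    then show ?case
      using el[of "fst a" "snd a"] by (auto simp: tensor_el_def)
  qed
  then show ?thesis using c by simp
qed

lemma tensor_hom_eqI:
  assumes "abelian_group P" "f \<in> add_hom T P" "g \<in> add_hom T P"
    and "\<And>m n. \<lbrakk>m \<in> carrier M; n \<in> carrier N\<rbrakk> \<Longrightarrow> f (el m n) = g (el m n)"
    and "t \<in> carrier T"
  shows "f t = g t"
  using assms(5)
  by (rule tensor_induct)
    (use assms(1-4) tensor_abelian_group in \<open>simp_all add: add_hom_zero add_hom_diff\<close>)

text \<open>
  The sum that defines the lift is the homomorphism \<open>h\<close> with values \<open>\<beta>\<close> on the basis of the free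
  group, applied to the chosen representative. As \<open>\<beta>\<close> is balanced, \<open>h\<close> vanishes on the defining
  relations, so it takes the same value at every representative.
\<close>

lemma tensor_lift_coset:
  assumes "abelian_group P" and \<beta>: "balanced_map R M N P \<beta>"
    and h: "h \<in> hom F (add_monoid P)"
    and h_of: "\<And>m n. \<lbrakk>m \<in> carrier M; n \<in> carrier N\<rbrakk> \<Longrightarrow> h (frag_of (m, n)) = \<beta> m n"
    and c: "c \<in> carrier F"
  shows "tensor_lift P \<beta> (K #>\<^bsub>F\<^esub> c) = h c"
proof -
  interpret K: normal K F by (rule tensor_subgroup_normal)
  interpret P: abelian_group P by fact
  interpret h: group_hom F "add_monoid P" h
    using h P.a_group by (simp add: group_hom_def group_hom_axioms_def)
  have \<beta>1: "(\<lambda>m. \<beta> m n) \<in> add_hom M P" if "n \<in> carrier N" for n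
    using \<beta> that by (simp add: balanced_map_def)
  have \<beta>2: "\<beta> m \<in> add_hom N P" if "m \<in> carrier M" for m
    using \<beta> that by (simp add: balanced_map_def)
  have \<beta>3: "\<beta> (ract M m r) n = \<beta> m (lact N r n)"
    if "m \<in> carrier M" "r \<in> carrier R" "n \<in> carrier N" for m r n
    using \<beta> that by (simp add: balanced_map_def)
  have \<beta>_closed: "\<beta> m n \<in> carrier P" if "m \<in> carrier M" "n \<in> carrier N" for m n
    using add_hom_closed[OF \<beta>2] that by blast
  have h_diff: "h (c - d) = h c \<ominus>\<^bsub>P\<^esub> h d" if "c \<in> carrier F" "d \<in> carrier F" for c d
    using h.hom_mult[of c "- d"] h.hom_inv[of d, folded a_inv_def] that by (simp add: a_minus_def)
  have h_sum: "h (\<Sum>k\<in>I. frag_cmul (u k) (frag_of k)) =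
      (\<Oplus>\<^bsub>P\<^esub>k\<in>I. [u k] \<cdot>\<^bsub>P\<^esub> \<beta> (fst k) (snd k))"
    if "finite I" "I \<subseteq> carrier M \<times> carrier N" for I and u :: "_ \<Rightarrow> int"
    using that
  proof (induction I rule: finite_induct)
    case empty
    then show ?case using h.hom_one by simp
  next
    case (insert k I)
    have summand: "h (frag_cmul (u k) (frag_of k)) = [u k] \<cdot>\<^bsub>P\<^esub> \<beta> (fst k) (snd k)"
      using h.hom_int_pow[of "frag_of k" "u k"] insert.prems h_of[of "fst k" "snd k"]
      by (auto simp: add_pow_def)
    have closed: "\<beta> (fst k) (snd k) \<in> carrier P" if "k \<in> carrier M \<times> carrier N" for k
      using \<beta>_closed that by auto
    have sum_closed: "(\<Sum>k\<in>I. frag_cmul (u k) (frag_of k)) \<in> carrier F"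
      using insert.prems by (intro sum_closed_free_Abelian_group) auto
    have summand_closed: "frag_cmul (u k) (frag_of k) \<in> carrier F"
      using insert.prems by auto
    have IH: "h (\<Sum>k\<in>I. frag_cmul (u k) (frag_of k)) =
        (\<Oplus>\<^bsub>P\<^esub>k\<in>I. [u k] \<cdot>\<^bsub>P\<^esub> \<beta> (fst k) (snd k))"
      using insert.prems by (intro insert.IH) blast
    have "h (\<Sum>k\<in>insert k I. frag_cmul (u k) (frag_of k)) =
        h (frag_cmul (u k) (frag_of k)) \<oplus>\<^bsub>P\<^esub> h (\<Sum>k\<in>I. frag_cmul (u k) (frag_of k))"
      unfolding sum.insert[OF insert.hyps]
      using h.hom_mult[OF summand_closed sum_closed] by (simp only: mult_free_Abelian_group monoid.simps)
    also have "\<dots> = [u k] \<cdot>\<^bsub>P\<^esub> \<beta> (fst k) (snd k) \<oplus>\<^bsub>P\<^esub>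
        (\<Oplus>\<^bsub>P\<^esub>k\<in>I. [u k] \<cdot>\<^bsub>P\<^esub> \<beta> (fst k) (snd k))"
      unfolding summand IH ..
    also have "\<dots> = (\<Oplus>\<^bsub>P\<^esub>k\<in>insert k I. [u k] \<cdot>\<^bsub>P\<^esub> \<beta> (fst k) (snd k))"
    proof (rule P.finsum_insert[symmetric])
      show "(\<lambda>k. [u k] \<cdot>\<^bsub>P\<^esub> \<beta> (fst k) (snd k)) \<in> I \<rightarrow> carrier P"
        using insert.prems P.add.int_pow_closed[OF closed] by (auto simp only: Pi_iff)
      show "[u k] \<cdot>\<^bsub>P\<^esub> \<beta> (fst k) (snd k) \<in> carrier P"
        using insert.prems by (intro P.add.int_pow_closed closed) blast
    qed (rule insert.hyps)+
    finally show ?case .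
  qed
  have cancel: "a \<oplus>\<^bsub>P\<^esub> b \<ominus>\<^bsub>P\<^esub> a \<ominus>\<^bsub>P\<^esub> b = \<zero>\<^bsub>P\<^esub>" if "a \<in> carrier P" "b \<in> carrier P" for a b
    using that by (simp add: P.minus_eq P.a_comm[of a b] P.a_assoc P.r_neg)
  have h_rel: "h k = \<zero>\<^bsub>P\<^esub>" if k: "k \<in> tensor_relations R M N" for k
  proof -
    consider (left) m m' n where "m \<in> carrier M" "m' \<in> carrier M" "n \<in> carrier N"
        "k = frag_of (m \<oplus>\<^bsub>M\<^esub> m', n) - frag_of (m, n) - frag_of (m', n)"
      | (right) m n n' where "m \<in> carrier M" "n \<in> carrier N" "n' \<in> carrier N"
        "k = frag_of (m, n \<oplus>\<^bsub>N\<^esub> n') - frag_of (m, n) - frag_of (m, n')"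
      | (middle) m r n where "m \<in> carrier M" "r \<in> carrier R" "n \<in> carrier N"
        "k = frag_of (ract M m r, n) - frag_of (m, lact N r n)"
      using k unfolding tensor_relations_def Un_iff mem_Collect_eq
      by (elim disjE exE conjE) (rule that; assumption)+
    then show ?thesis
    proof cases
      case left
      have "frag_of (m \<oplus>\<^bsub>M\<^esub> m', n) - frag_of (m, n) \<in> carrier F"
        using left keys_diff[of "frag_of (m \<oplus>\<^bsub>M\<^esub> m', n)" "frag_of (m, n)"] by auto
      then show ?thesis
        using left cancel[OF \<beta>_closed \<beta>_closed, of m n m' n] add_hom_add[OF \<beta>1, of n m m']
        by (simp add: h_diff h_of)
    next
      case right
      have "frag_of (m, n \<oplus>\<^bsub>N\<^esub> n') - frag_of (m, n) \<in> carrier F"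
        using right keys_diff[of "frag_of (m, n \<oplus>\<^bsub>N\<^esub> n')" "frag_of (m, n)"] by auto
      then show ?thesis
        using right cancel[OF \<beta>_closed \<beta>_closed, of m n m n'] add_hom_add[OF \<beta>2, of m n n']
        by (simp add: h_diff h_of)
    next
      case middle
      then show ?thesis
        using \<beta>3[of m r n] \<beta>_closed
        by (simp add: h_diff h_of M.ract_closed N.lact_closed P.minus_eq P.r_neg)
    qed
  qed
  have h_zero: "h k = \<zero>\<^bsub>P\<^esub>" if "k \<in> K" for k
    using that unfolding tensor_subgroup_def
  proof (induction k rule: generate.induct)
    case one
    then show ?case using h.hom_one by simp
  next
    case (incl k)
    then show ?case
      using h_rel by blast
  next
    case (inv k)
    then have "k \<in> carrier F" using tensor_relations_subset by blast
    then show ?case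
      using h.hom_inv[of k, folded a_inv_def] h_rel[of k] inv by simp
  next
    case (eng k l)
    then have "k \<in> carrier F" "l \<in> carrier F"
      using K.subset unfolding tensor_subgroup_def by blast+
    then show ?case
      using h.hom_mult[of k l] eng by simp
  qed
  \<comment> \<open>the representative that the lift picks\<close>
  define d where "d = (SOME d. d \<in> K #>\<^bsub>F\<^esub> c)"
  have "c \<in> K #>\<^bsub>F\<^esub> c"
    using K.rcos_self[OF c K.subgroup_axioms] .
  then have "d \<in> K #>\<^bsub>F\<^esub> c"
    unfolding d_def by (rule someI)
  then obtain k where k: "k \<in> K" "d = k + c"
    by (auto simp: r_coset_def)
  have "k \<in> carrier F" using k K.subset by blast
  then have d: "d \<in> carrier F" "h d = h c"
    using k c h.hom_mult[of k c] h_zero[of k] h.hom_closed[of c] by (auto dest: set_mp[OF keys_add])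
  have "tensor_lift P \<beta> (K #>\<^bsub>F\<^esub> c) = h (\<Sum>k\<in>Poly_Mapping.keys d. frag_cmul (Poly_Mapping.lookup d k) (frag_of k))"
    unfolding tensor_lift_def d_def[symmetric] Let_def
    using d by (intro h_sum[symmetric] finite_keys) simp
  also have "\<dots> = h d"
    using arg_cong[OF frag_expansion[of d, unfolded frag_extend_def], of h] by (rule sym)
  finally show ?thesis using d by simp
qed

lemma
  assumes "abelian_group P" and \<beta>: "balanced_map R M N P \<beta>"
  shows tensor_lift_add_hom: "tensor_lift P \<beta> \<in> add_hom T P"
    and tensor_lift_el: "\<lbrakk>m \<in> carrier M; n \<in> carrier N\<rbrakk> \<Longrightarrow> tensor_lift P \<beta> (el m n) = \<beta> m n"
proof -
  interpret P: abelian_group P by fact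
  have "\<beta> m n \<in> carrier P" if "m \<in> carrier M" "n \<in> carrier N" for m n
    using \<beta> that by (auto simp: balanced_map_def dest: add_hom_closed)
  then have "(\<lambda>k. \<beta> (fst k) (snd k)) ` (carrier M \<times> carrier N) \<subseteq> carrier (add_monoid P)"
    by auto
  then obtain h where h: "h \<in> hom F (add_monoid P)"
    and h_of: "\<And>k. k \<in> carrier M \<times> carrier N \<Longrightarrow> h (frag_of k) = \<beta> (fst k) (snd k)"
    by (rule comm_group.free_Abelian_group_universal[OF P.a_comm_group]) blast
  have lift: "tensor_lift P \<beta> (K #>\<^bsub>F\<^esub> c) = h c" if "c \<in> carrier F" for c
    using tensor_lift_coset[OF assms h] h_of that by simp
  show "tensor_lift P \<beta> \<in> add_hom T P"
  proof (rule add_homI)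
    fix t assume "t \<in> carrier T"
    then obtain c where "c \<in> carrier F" "t = K #>\<^bsub>F\<^esub> c" unfolding carrier_tensor by auto
    then show "tensor_lift P \<beta> t \<in> carrier P"
      using lift hom_in_carrier[OF h] by simp
    fix u assume "u \<in> carrier T"
    then obtain d where "d \<in> carrier F" "u = K #>\<^bsub>F\<^esub> d" unfolding carrier_tensor by auto
    moreover have "c + d \<in> carrier F"
      using \<open>c \<in> carrier F\<close> \<open>d \<in> carrier F\<close> keys_add[of c d] by auto
    ultimately show "tensor_lift P \<beta> (t \<oplus>\<^bsub>T\<^esub> u) = tensor_lift P \<beta> t \<oplus>\<^bsub>P\<^esub> tensor_lift P \<beta> u"
      using \<open>c \<in> carrier F\<close> \<open>t = K #>\<^bsub>F\<^esub> c\<close> hom_mult[OF h, of c d]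
      by (simp del: carrier_free_Abelian_group_iff add: add_coset lift)
  qed
  show "tensor_lift P \<beta> (el m n) = \<beta> m n" if "m \<in> carrier M" "n \<in> carrier N"
    using lift[of "frag_of (m, n)"] h_of[of "(m, n)"] that by (simp add: tensor_el_def)
qed

lemma ract_tensor: "ract T t s = tensor_lift T (\<lambda>m n. el m (ract N n s)) t"
proof -
  have "tensor_lift (tensor_group R M N) = (tensor_lift T :: ('m \<Rightarrow> 'n \<Rightarrow> _) \<Rightarrow> _)"
    by (rule tensor_lift_cong) (simp_all add: tensor_def Let_def)
  then have "tensor_lift T = (tensor_lift (tensor_group R M N) :: ('m \<Rightarrow> 'n \<Rightarrow> _) \<Rightarrow> _)" ..
  then show ?thesis
    by (subst tensor_def) (simp add: Let_def)
qed

lemma ract_balanced_map: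
  "s \<in> carrier S \<Longrightarrow> balanced_map R M N T (\<lambda>m n. el m (ract N n s))"
  by (intro balanced_mapI add_homI)
    (simp_all add: el_closed el_add_left el_add_right el_balanced N.ract_closed N.add_ract N.lact_ract)

lemma ract_tensor_add_hom: "s \<in> carrier S \<Longrightarrow> (\<lambda>t. ract T t s) \<in> add_hom T T"
  unfolding ract_tensor by (intro tensor_lift_add_hom tensor_abelian_group ract_balanced_map)

lemma ract_el:
  "\<lbrakk>m \<in> carrier M; n \<in> carrier N; s \<in> carrier S\<rbrakk> \<Longrightarrow> ract T (el m n) s = el m (ract N n s)"
  unfolding ract_tensor by (intro tensor_lift_el tensor_abelian_group ract_balanced_map)

lemma tensor_right_module: "right_module S T"
proof (rule right_module.intro)
  interpret T: abelian_group T by (rule tensor_abelian_group)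
  show "ring S" by (rule right_module.axioms(1)[OF bimodule_right_module[OF right_factor]])
  interpret S: ring S by fact
  show "abelian_group T" by (rule tensor_abelian_group)
  have id_hom: "(\<lambda>t. t) \<in> add_hom T T" by (rule add_homI) simp_all
  show "right_module_axioms S T"
  proof
    fix t s assume t: "t \<in> carrier T" and s: "s \<in> carrier S"
    show "ract T t s \<in> carrier T"
      using add_hom_closed[OF ract_tensor_add_hom[OF s] t] .
    show "ract T (t \<oplus>\<^bsub>T\<^esub> u) s = ract T t s \<oplus>\<^bsub>T\<^esub> ract T u s" if "u \<in> carrier T" for u
      using add_hom_add[OF ract_tensor_add_hom[OF s] t that] .
    fix r assume r: "r \<in> carrier S"
    show "ract T t (s \<oplus>\<^bsub>S\<^esub> r) = ract T t s \<oplus>\<^bsub>T\<^esub> ract T t r"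
      by (rule tensor_hom_eqI[OF tensor_abelian_group _ _ _ t])
        (use s r in \<open>simp_all add: ract_tensor_add_hom add_hom_sum tensor_abelian_group ract_el
            N.ract_add N.ract_closed el_add_right\<close>)
    show "ract T t (s \<otimes>\<^bsub>S\<^esub> r) = ract T (ract T t s) r"
      by (rule tensor_hom_eqI[OF tensor_abelian_group _ _ _ t])
        (use s r in \<open>simp_all add: ract_tensor_add_hom add_hom_comp[OF ract_tensor_add_hom ract_tensor_add_hom]
            ract_el N.ract_mult N.ract_closed\<close>)
  next
    fix t assume t: "t \<in> carrier T"
    show "ract T t \<one>\<^bsub>S\<^esub> = t"
      by (rule tensor_hom_eqI[OF tensor_abelian_group _ id_hom _ t])
        (simp_all add: ract_tensor_add_hom ract_el N.ract_one)
  qed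
qed

lemma tensor_right_linear_eqI:
  assumes "right_module S P" "right_linear S T P f" "right_linear S T P g"
    and "\<And>m n. \<lbrakk>m \<in> carrier M; n \<in> carrier N\<rbrakk> \<Longrightarrow> f (el m n) = g (el m n)"
    and "t \<in> carrier T"
  shows "f t = g t"
  using tensor_hom_eqI[OF right_module_abelian_group[OF assms(1)]] assms(2-5)
  by (blast dest: right_linear_add_hom)

lemma tensor_lift_right_linear:
  assumes P: "right_module S P" and \<beta>: "balanced_map R M N P \<beta>"
    and \<beta>_ract: "\<And>m n s. \<lbrakk>m \<in> carrier M; n \<in> carrier N; s \<in> carrier S\<rbrakk>
      \<Longrightarrow> \<beta> m (ract N n s) = ract P (\<beta> m n) s"
  shows "right_linear S T P (tensor_lift P \<beta>)"
  unfolding right_linear_def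
proof (intro conjI ballI)
  interpret P: right_module S P by (rule P)
  note lift = tensor_lift_add_hom[OF P.abelian_group_axioms \<beta>]
  show "tensor_lift P \<beta> \<in> add_hom T P" by (rule lift)
  fix t s assume t: "t \<in> carrier T" and s: "s \<in> carrier S"
  have P_ract: "(\<lambda>p. ract P p s) \<in> add_hom P P"
    by (rule add_homI) (use s in \<open>simp_all add: P.ract_closed P.add_ract\<close>)
  show "tensor_lift P \<beta> (ract T t s) = ract P (tensor_lift P \<beta> t) s"
    by (rule tensor_hom_eqI[OF P.abelian_group_axioms
          add_hom_comp[OF ract_tensor_add_hom[OF s] lift] add_hom_comp[OF lift P_ract] _ t])
      (use s in \<open>simp add: ract_el N.ract_closed tensor_lift_el[OF P.abelian_group_axioms \<beta>] \<beta>_ract\<close>)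
qed

end

section \<open>Tensor products of bimodules and of linear maps\<close>

lemma tensor_bimodule_simps [simp]:
  "carrier (tensor_bimodule R M N) = carrier (tensor R M N)"
  "ring.add (tensor_bimodule R M N) = ring.add (tensor R M N)"
  "ring.zero (tensor_bimodule R M N) = ring.zero (tensor R M N)"
  "ract (tensor_bimodule R M N) = ract (tensor R M N)"
  by (simp_all add: tensor_bimodule_def Let_def)

text \<open>
  Serves to pass between records of different types with the same module structure.
\<close>

lemma right_module_cong:
  assumes "right_module S M" "carrier M' = carrier M" "ring.add M' = ring.add M"
    "ring.zero M' = ring.zero M" "ract M' = ract M"
  shows "right_module S M'"
proof -
  interpret right_module S M by fact
  have "abelian_group M'"
    by (rule abelian_groupI)
      (use assms(2-4) M.l_neg in \<open>auto simp: M.a_assoc intro: M.a_comm\<close>)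
  then show ?thesis
    by (intro right_module.intro right_module_axioms.intro S.ring_axioms)
      (simp_all add: assms ract_closed ract_add add_ract ract_mult ract_one)
qed

lemma tensor_bimodule_lact:
  "lact (tensor_bimodule R M N) q t = tensor_lift (tensor R M N) (\<lambda>m n. tensor_el R M N (lact M q m) n) t"
  by (simp add: tensor_bimodule_def Let_def)

text \<open>
  Each bimodule axiom equates two maps that are additive in the tensor, so it reduces to the corresponding
  axiom for \<open>M\<close> or \<open>N\<close> on the elements \<open>m \<otimes> n\<close>.
\<close>

lemma
  assumes M: "bimodule Q R M" and N: "bimodule R S N"
  shows bimodule_tensor_bimodule: "bimodule Q S (tensor_bimodule R M N)"
    and lact_tensor_el: "\<And>q m n. \<lbrakk>q \<in> carrier Q; m \<in> carrier M; n \<in> carrier N\<rbrakk>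
      \<Longrightarrow> lact (tensor_bimodule R M N) q (tensor_el R M N m n) = tensor_el R M N (lact M q m) n"
proof -
  interpret M: bimodule Q R M by fact
  interpret N: bimodule R S N by fact
  interpret MN: tensor_factors R S M N
    using M N by (simp add: tensor_factors_def bimodule_right_module)
  let ?T = "tensor_bimodule R M N"
  have balanced: "balanced_map R M N MN.T (\<lambda>m n. MN.el (lact M q m) n)" if "q \<in> carrier Q" for q
    by (intro balanced_mapI add_homI)
      (use that in \<open>simp_all add: MN.el_closed MN.el_add_left MN.el_add_right M.lact_closed M.lact_add
         flip: MN.el_balanced M.lact_ract\<close>)
  have hom: "lact ?T q \<in> add_hom MN.T MN.T" if "q \<in> carrier Q" for q
    unfolding tensor_bimodule_lact[abs_def]
    by (rule MN.tensor_lift_add_hom[OF MN.tensor_abelian_group balanced[OF that]])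
  show el: "lact ?T q (MN.el m n) = MN.el (lact M q m) n"
    if "q \<in> carrier Q" "m \<in> carrier M" "n \<in> carrier N" for q m n
    unfolding tensor_bimodule_lact
    by (rule MN.tensor_lift_el[OF MN.tensor_abelian_group balanced[OF that(1)] that(2,3)])
  have T_right: "right_module S ?T"
    by (rule right_module_cong[OF MN.tensor_right_module]) simp_all
  have id_hom: "(\<lambda>t. t) \<in> add_hom MN.T MN.T" 
    by (rule add_homI) simp_all
  show "bimodule Q S ?T"
  proof (rule bimodule.intro[OF M.R.ring_axioms T_right], unfold_locales)
    fix q t assume q: "q \<in> carrier Q" and t: "t \<in> carrier ?T"
    then have t': "t \<in> carrier MN.T" by simp
    show "lact ?T q t \<in> carrier ?T"
      using add_hom_closed[OF hom[OF q] t'] by simp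
    show "lact ?T q (t \<oplus>\<^bsub>?T\<^esub> u) = lact ?T q t \<oplus>\<^bsub>?T\<^esub> lact ?T q u" if "u \<in> carrier ?T" for u
      using add_hom_add[OF hom[OF q] t', of u] that by simp
    show "ract ?T (lact ?T q t) s = lact ?T q (ract ?T t s)" if s: "s \<in> carrier S" for s
    proof -
      note ract_hom = MN.ract_tensor_add_hom[OF s]
      have "ract MN.T (lact ?T q t) s = lact ?T q (ract MN.T t s)"
        by (rule MN.tensor_hom_eqI[OF MN.tensor_abelian_group
              add_hom_comp[OF hom[OF q] ract_hom] add_hom_comp[OF ract_hom hom[OF q]] _ t'])
          (use q s in \<open>simp add: el MN.ract_el M.lact_closed N.ract_closed\<close>)
      then show ?thesis by simp
    qed
    fix r assume r: "r \<in> carrier Q"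
    have "lact ?T (q \<oplus>\<^bsub>Q\<^esub> r) t = lact ?T q t \<oplus>\<^bsub>MN.T\<^esub> lact ?T r t"
      by (rule MN.tensor_hom_eqI[OF MN.tensor_abelian_group _ _ _ t'])
        (use q r in \<open>simp_all add: hom add_hom_sum MN.tensor_abelian_group el
            M.add_lact M.lact_closed MN.el_add_left\<close>)
    then show "lact ?T (q \<oplus>\<^bsub>Q\<^esub> r) t = lact ?T q t \<oplus>\<^bsub>?T\<^esub> lact ?T r t" by simp
    show "lact ?T (q \<otimes>\<^bsub>Q\<^esub> r) t = lact ?T q (lact ?T r t)"
      by (rule MN.tensor_hom_eqI[OF MN.tensor_abelian_group _ _ _ t'])
        (use q r in \<open>simp_all add: hom add_hom_comp[OF hom hom] el M.mult_lact M.lact_closed\<close>)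
  next
    fix t assume "t \<in> carrier ?T"
    then have t: "t \<in> carrier MN.T" by simp
    show "lact ?T \<one>\<^bsub>Q\<^esub> t = t"
      by (rule MN.tensor_hom_eqI[OF MN.tensor_abelian_group _ id_hom _ t])
        (simp_all add: hom el M.one_lact)
  qed
qed

lemma
  assumes M: "right_module R M" and N: "bimodule R S N"
    and M': "right_module R M'" and N': "bimodule R S N'"
    and f: "right_linear R M M' f" and g: "bilinear_map R S N N' g"
  shows tensor_map_right_linear:
      "right_linear S (tensor R M N) (tensor R M' N') (tensor_map R M' N' f g)"
    and tensor_map_el: "\<And>m n. \<lbrakk>m \<in> carrier M; n \<in> carrier N\<rbrakk>
      \<Longrightarrow> tensor_map R M' N' f g (tensor_el R M N m n) = tensor_el R M' N' (f m) (g n)"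
proof -
  interpret MN: tensor_factors R S M N using M N by (rule tensor_factors.intro)
  interpret MN': tensor_factors R S M' N' using M' N' by (rule tensor_factors.intro)
  note f_hom = right_linear_add_hom[OF f]
  note g_hom = right_linear_add_hom[OF bilinear_map_right_linear[OF g]]
  have balanced: "balanced_map R M N MN'.T (\<lambda>m n. MN'.el (f m) (g n))"
    by (intro balanced_mapI add_homI)
      (simp_all add: MN'.el_closed MN'.el_add_left MN'.el_add_right MN'.el_balanced
        add_hom_closed[OF f_hom] add_hom_closed[OF g_hom] add_hom_add[OF f_hom] add_hom_add[OF g_hom]
        right_linear_ract[OF f] bilinear_map_lact[OF g])
  show "right_linear S MN.T MN'.T (tensor_map R M' N' f g)"
    unfolding tensor_map_def
    by (rule MN.tensor_lift_right_linear[OF MN'.tensor_right_module balanced])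
      (simp add: MN'.ract_el add_hom_closed[OF f_hom] add_hom_closed[OF g_hom]
        right_linear_ract[OF bilinear_map_right_linear[OF g]])
  show "tensor_map R M' N' f g (MN.el m n) = MN'.el (f m) (g n)"
    if "m \<in> carrier M" "n \<in> carrier N" for m n
    unfolding tensor_map_def
    by (rule MN.tensor_lift_el[OF MN'.tensor_abelian_group balanced that])
qed

text \<open>
  The associativity map is the lift of a map \<open>\<gamma>\<close> that, for each \<open>p\<close>, is itself a lift
  \<open>M \<otimes> N \<rightarrow> M \<otimes> (N \<otimes> P)\<close>. The remaining conditions on \<open>\<gamma>\<close>, additivity in \<open>p\<close> and balancedness, equate
  maps that are additive in \<open>t \<in> M \<otimes> N\<close>, so they need to be verified for \<open>t = m \<otimes> n\<close> only.
\<close>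

lemma
  assumes M: "right_module R M" and N: "bimodule R R N" and P: "bimodule R S P"
  shows tensor_assoc_right_linear: 
      "right_linear S (tensor R (tensor R M N) P) (tensor R M (tensor_bimodule R N P))
        (tensor_assoc R M N P)"
    and tensor_assoc_el: "\<And>m n p. \<lbrakk>m \<in> carrier M; n \<in> carrier N; p \<in> carrier P\<rbrakk> \<Longrightarrow>
      tensor_assoc R M N P (tensor_el R (tensor R M N) P (tensor_el R M N m n) p) =
      tensor_el R M (tensor_bimodule R N P) m (tensor_el R N P n p)"
proof -
  let ?NP = "tensor_bimodule R N P"
  interpret MN: tensor_factors R R M N using M N by (rule tensor_factors.intro)
  interpret NP: tensor_factors R S N P using bimodule_right_module[OF N] P by (rule tensor_factors.intro)
  have NP: "bimodule R S ?NP" by (rule bimodule_tensor_bimodule[OF N P])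
  interpret M_NP: tensor_factors R S M ?NP using M NP by (rule tensor_factors.intro)
  interpret MN_P: tensor_factors R S MN.T P using MN.tensor_right_module P by (rule tensor_factors.intro)
  interpret M: right_module R M by (rule M)
  interpret N: bimodule R R N by (rule N)
  interpret P: bimodule R S P by (rule P)
  interpret T: abelian_group M_NP.T by (rule M_NP.tensor_abelian_group)
  define \<beta> where "\<beta> p = (\<lambda>m n. M_NP.el m (NP.el n p))" for p
  have \<beta>_balanced: "balanced_map R M N M_NP.T (\<beta> p)" if p: "p \<in> carrier P" for p
  proof (intro balanced_mapI add_homI)
    fix m r n assume *: "m \<in> carrier M" "r \<in> carrier R" "n \<in> carrier N"
    then show "\<beta> p (ract M m r) n = \<beta> p m (lact N r n)"
      using p by (simp add: \<beta>_def M_NP.el_balanced NP.el_closed lact_tensor_el[OF N P])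
  next
    fix m n n' assume *: "m \<in> carrier M" "n \<in> carrier N" "n' \<in> carrier N"
    then show "\<beta> p m (n \<oplus>\<^bsub>N\<^esub> n') = \<beta> p m n \<oplus>\<^bsub>M_NP.T\<^esub> \<beta> p m n'"
      using p M_NP.el_add_right[of m "NP.el n p" "NP.el n' p"]
      by (simp add: \<beta>_def NP.el_closed NP.el_add_left)
  qed (use p in \<open>simp_all add: \<beta>_def M_NP.el_closed M_NP.el_add_left NP.el_closed\<close>)
  note lift_hom = MN.tensor_lift_add_hom[OF T.abelian_group_axioms \<beta>_balanced]
  note lift_el = MN.tensor_lift_el[OF T.abelian_group_axioms \<beta>_balanced]
  define \<gamma> where "\<gamma> = (\<lambda>t p. tensor_lift M_NP.T (\<beta> p) t)"
  have assoc: "tensor_assoc R M N P = tensor_lift M_NP.T \<gamma>"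
    by (simp add: tensor_assoc_def Let_def \<gamma>_def \<beta>_def)
  have \<gamma>_hom: "(\<lambda>t. \<gamma> t p) \<in> add_hom MN.T M_NP.T" if "p \<in> carrier P" for p
    using lift_hom[OF that] by (simp add: \<gamma>_def)
  have \<gamma>_el: "\<gamma> (MN.el m n) p = M_NP.el m (NP.el n p)"
    if "m \<in> carrier M" "n \<in> carrier N" "p \<in> carrier P" for m n p
    using lift_el[of p m n] that by (simp add: \<gamma>_def \<beta>_def)
  have \<gamma>_balanced: "balanced_map R MN.T P M_NP.T \<gamma>"
  proof (intro balanced_mapI \<gamma>_hom add_homI)
    fix t assume t: "t \<in> carrier MN.T"
    show "\<gamma> t p \<in> carrier M_NP.T" if "p \<in> carrier P" for p
      using add_hom_closed[OF \<gamma>_hom[OF that] t] .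
    show "\<gamma> t (p \<oplus>\<^bsub>P\<^esub> p') = \<gamma> t p \<oplus>\<^bsub>M_NP.T\<^esub> \<gamma> t p'" if p: "p \<in> carrier P" "p' \<in> carrier P" for p p'
    proof (rule MN.tensor_hom_eqI[OF T.abelian_group_axioms \<gamma>_hom add_hom_sum[OF T.abelian_group_axioms \<gamma>_hom \<gamma>_hom] _ t])
      fix m n assume "m \<in> carrier M" "n \<in> carrier N"
      then show "\<gamma> (MN.el m n) (p \<oplus>\<^bsub>P\<^esub> p') = \<gamma> (MN.el m n) p \<oplus>\<^bsub>M_NP.T\<^esub> \<gamma> (MN.el m n) p'"
        using p M_NP.el_add_right[of m "NP.el n p" "NP.el n p'"]
        by (simp add: \<gamma>_el NP.el_closed NP.el_add_right)
    qed (use p in simp_all)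
    show "\<gamma> (ract MN.T t r) p = \<gamma> t (lact P r p)" if r: "r \<in> carrier R" and p: "p \<in> carrier P" for r p
    proof (rule MN.tensor_hom_eqI[OF T.abelian_group_axioms
          add_hom_comp[OF MN.ract_tensor_add_hom[OF r] \<gamma>_hom[OF p]] \<gamma>_hom _ t])
      fix m n assume "m \<in> carrier M" "n \<in> carrier N"
      then show "\<gamma> (ract MN.T (MN.el m n) r) p = \<gamma> (MN.el m n) (lact P r p)"
        using r p by (simp add: \<gamma>_el MN.ract_el N.ract_closed P.lact_closed NP.el_balanced)
    qed (use r p in \<open>simp add: P.lact_closed\<close>)
  qed
  show "right_linear S MN_P.T M_NP.T (tensor_assoc R M N P)"
    unfolding assoc
  proof (rule MN_P.tensor_lift_right_linear[OF M_NP.tensor_right_module \<gamma>_balanced])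
    fix t p s assume t: "t \<in> carrier MN.T" and p: "p \<in> carrier P" and s: "s \<in> carrier S"
    have ps: "ract P p s \<in> carrier P" using p s by (rule P.ract_closed)
    show "\<gamma> t (ract P p s) = ract M_NP.T (\<gamma> t p) s"
      by (rule MN.tensor_hom_eqI[OF T.abelian_group_axioms \<gamma>_hom[OF ps]
            add_hom_comp[OF \<gamma>_hom[OF p] M_NP.ract_tensor_add_hom[OF s]] _ t])
        (use p s ps in \<open>simp add: \<gamma>_el M_NP.ract_el NP.el_closed NP.ract_el\<close>)
  qed
  show "tensor_assoc R M N P (MN_P.el (MN.el m n) p) = M_NP.el m (NP.el n p)"
    if "m \<in> carrier M" "n \<in> carrier N" "p \<in> carrier P" for m n p
    unfolding assoc
    using MN_P.tensor_lift_el[OF T.abelian_group_axioms \<gamma>_balanced MN.el_closed that(3)] that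
    by (simp add: \<gamma>_el)
qed

lemma bimodule_ring_bimodule:
  assumes "ring R" "ring A" "f \<in> ring_hom R A"
  shows "bimodule R A (ring_bimodule f A)"
proof -
  interpret R: ring R by fact
  interpret A: ring A by fact
  have "abelian_group (ring_bimodule f A)"
    by (rule abelian_groupI) (auto simp: ring_bimodule_def A.a_assoc intro: A.a_comm A.a_inv_closed A.l_neg)
  then show ?thesis
    using assms(3)
    by (intro bimodule.intro right_module.intro right_module_axioms.intro bimodule_axioms.intro)
      (simp_all add: ring_bimodule_def R.ring_axioms A.ring_axioms A.l_distr A.r_distr A.m_assoc
        ring_hom_closed ring_hom_add ring_hom_mult ring_hom_one)
qed

lemma
  assumes M: "right_module A M"
  shows right_unitor_right_linear:
      "right_linear A (tensor A M (ring_bimodule id A)) M (right_unitor M)"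
    and right_unitor_el: "\<And>m a. \<lbrakk>m \<in> carrier M; a \<in> carrier A\<rbrakk>
      \<Longrightarrow> right_unitor M (tensor_el A M (ring_bimodule id A) m a) = ract M m a"
proof -
  interpret M: right_module A M by (rule M)
  have A': "bimodule A A (ring_bimodule id A)"
    by (rule bimodule_ring_bimodule) (simp_all add: M.S.ring_axioms ring_hom_def)
  interpret MA: tensor_factors A A M "ring_bimodule id A" using M A' by (rule tensor_factors.intro)
  have balanced: "balanced_map A M (ring_bimodule id A) M (ract M)"
    by (intro balanced_mapI add_homI)
      (simp_all add: ring_bimodule_def M.ract_closed M.ract_add M.add_ract M.ract_mult)
  show "right_linear A MA.T M (right_unitor M)"
    unfolding right_unitor_def
    by (rule MA.tensor_lift_right_linear[OF M balanced]) (simp add: ring_bimodule_def M.ract_mult)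
  show "right_unitor M (MA.el m a) = ract M m a" if "m \<in> carrier M" "a \<in> carrier A" for m a
    unfolding right_unitor_def
    by (rule MA.tensor_lift_el[OF M.abelian_group_axioms balanced])
      (use that in \<open>simp_all add: ring_bimodule_def\<close>)
qed

section \<open>Underlying right modules\<close>

text \<open>
  All constructions on a comodule depend only on its underlying right module. This is what makes the
  copies \<open>\<mu>\<^sub>\<alpha>(M)\<close> of a comodule inherit its structure.
\<close>

lemma truncate_simps [simp]:
  "carrier (right_module.truncate M) = carrier M"
  "ring.add (right_module.truncate M) = ring.add M"
  "ring.zero (right_module.truncate M) = ring.zero M"
  "ract (right_module.truncate M) = ract M"
  by (simp_all add: right_module.truncate_def)

lemma right_module_truncate: "right_module S M \<Longrightarrow> right_module S (right_module.truncate M)"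
  by (rule right_module_cong) simp_all

lemma right_linear_truncate [simp]:
  "right_linear S (right_module.truncate M) N f = right_linear S M N f"
  "right_linear S M (right_module.truncate N) f = right_linear S M N f"
  by (simp_all add: right_linear_def hom_def)

lemma rmod_hom_truncate [simp]:
  "rmod_hom S (right_module.truncate M) N = rmod_hom S M N"
  "rmod_hom S M (right_module.truncate N) = rmod_hom S M N"
  by (simp_all add: rmod_hom_def)

lemma tensor_subgroup_truncate: "tensor_subgroup R (right_module.truncate M) N = tensor_subgroup R M N"
  by (simp add: tensor_subgroup_def tensor_relations_def)

lemma tensor_el_truncate [simp]: "tensor_el R (right_module.truncate M) N = tensor_el R M N"
  by (simp add: fun_eq_iff tensor_el_def tensor_subgroup_truncate)

lemma tensor_truncate [simp]: "tensor R (right_module.truncate M) N = tensor R M N"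
  by (simp add: tensor_def tensor_group_def tensor_subgroup_truncate)

lemma tensor_map_truncate [simp]: "tensor_map R (right_module.truncate M) N = tensor_map R M N"
  by (simp add: fun_eq_iff tensor_map_def)

lemma tensor_assoc_truncate [simp]: "tensor_assoc R (right_module.truncate M) N P = tensor_assoc R M N P"
  by (simp add: fun_eq_iff tensor_assoc_def)

lemma right_unitor_truncate [simp]:
  fixes M :: "('a, 'm, 'x) right_module_scheme"
  shows "right_unitor (right_module.truncate M) = right_unitor M"
proof -
  have "tensor_lift (right_module.truncate M) = (tensor_lift M :: ('m \<Rightarrow> 'a \<Rightarrow> 'm) \<Rightarrow> _)"
    by (rule tensor_lift_cong) simp_all
  then show ?thesis by (simp add: right_unitor_def)
qed

section \<open>The categories\<close>

lemma right_linear_closed: "\<lbrakk>right_linear S M N f; m \<in> carrier M\<rbrakk> \<Longrightarrow> f m \<in> carrier N"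
  by (blast intro: add_hom_closed dest: right_linear_add_hom)

lemma right_linear_cong:
  assumes "right_module S M" and f: "right_linear S M N f" and "\<And>m. m \<in> carrier M \<Longrightarrow> g m = f m"
  shows "right_linear S M N g"
proof -
  interpret right_module S M by fact
  show ?thesis
    using assms(3) right_linear_closed[OF f] right_linear_ract[OF f] add_hom_add[OF right_linear_add_hom[OF f]]
    by (auto simp: right_linear_def ract_closed intro!: add_homI)
qed

lemma right_linear_id: "right_linear S M M (\<lambda>m. m)"
  by (auto simp: right_linear_def hom_def)

lemma right_linear_comp:
  assumes f: "right_linear S M N f" and g: "right_linear S N P g"
  shows "right_linear S M P (\<lambda>m. g (f m))"
  using add_hom_comp[OF right_linear_add_hom[OF f] right_linear_add_hom[OF g]]
    right_linear_closed[OF f] right_linear_ract[OF f] right_linear_ract[OF g]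
  by (simp add: right_linear_def)

lemma bilinear_map_id: "bilinear_map R S N N id"
  using right_linear_id by (simp add: bilinear_map_def right_linear_def hom_def)

lemma rmod_hom_right_linear: "f \<in> rmod_hom S M N \<Longrightarrow> right_linear S M N f"
  by (simp add: rmod_hom_def)

lemma rmod_hom_PiE: "f \<in> rmod_hom S M N \<Longrightarrow> f \<in> carrier M \<rightarrow>\<^sub>E carrier N"
  by (auto simp: rmod_hom_def PiE_def dest: right_linear_closed)

lemma rmod_hom_restrict:
  assumes "right_module S M" "right_linear S M N f"
  shows "restrict f (carrier M) \<in> rmod_hom S M N"
  using right_linear_cong[OF assms, of "restrict f (carrier M)"] by (simp add: rmod_hom_def)

lemma rmod_hom_compose:
  assumes "right_module S M" "f \<in> rmod_hom S M N" "g \<in> rmod_hom S N P"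
  shows "compose (carrier M) g f \<in> rmod_hom S M P"
  unfolding compose_def
  by (rule rmod_hom_restrict[OF assms(1)
        right_linear_comp[OF rmod_hom_right_linear[OF assms(2)] rmod_hom_right_linear[OF assms(3)]]])

lemma category_rmod_cat: "category (rmod_cat S)"
proof
  fix U V W Z f g h
  assume *: "U \<in> Ob (rmod_cat S)" "V \<in> Ob (rmod_cat S)" "f \<in> Hom (rmod_cat S) U V"
  then show "Cmp (rmod_cat S) U f (Idm (rmod_cat S) U) = f"
    "Cmp (rmod_cat S) U (Idm (rmod_cat S) V) f = f"
    using rmod_hom_PiE[of f S U V] by (auto simp: rmod_cat_def compose_Id Id_compose PiE_def)
  show "Cmp (rmod_cat S) U g f \<in> Hom (rmod_cat S) U W" if "g \<in> Hom (rmod_cat S) V W"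
    using * that rmod_hom_compose[of S U f V g W] by (simp add: rmod_cat_def)
next
  fix Z U V W f g h
  assume "f \<in> Hom (rmod_cat S) Z U" "Z \<in> Ob (rmod_cat S)"
  then show "Cmp (rmod_cat S) Z (Cmp (rmod_cat S) U h g) f = Cmp (rmod_cat S) Z h (Cmp (rmod_cat S) Z g f)"
    using rmod_hom_PiE[of f S Z U] by (simp add: rmod_cat_def compose_assoc[of f _ "carrier U"] PiE_def)
next
  fix U assume "U \<in> Ob (rmod_cat S)"
  then show "Idm (rmod_cat S) U \<in> Hom (rmod_cat S) U U"
    using rmod_hom_restrict[OF _ right_linear_id] by (simp add: rmod_cat_def)
qed

lemma tensor_map_id:
  assumes M: "right_module R M" and N: "bimodule R S N"
    and f: "right_linear R M M f" "\<And>m. m \<in> carrier M \<Longrightarrow> f m = m"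
    and t: "t \<in> carrier (tensor R M N)"
  shows "tensor_map R M N f id t = t"
proof -
  interpret MN: tensor_factors R S M N using M N by (rule tensor_factors.intro)
  show ?thesis
    by (rule MN.tensor_right_linear_eqI[OF MN.tensor_right_module
          tensor_map_right_linear[OF M N M N f(1) bilinear_map_id] right_linear_id _ t])
      (simp add: tensor_map_el[OF M N M N f(1) bilinear_map_id] f(2))
qed

lemma tensor_map_comp:
  assumes M: "right_module R M" and N: "bimodule R S N"
    and M': "right_module R M'" and M'': "right_module R M''"
    and f: "right_linear R M M' f" and g: "right_linear R M' M'' g"
    and h: "\<And>m. m \<in> carrier M \<Longrightarrow> h m = g (f m)"
    and t: "t \<in> carrier (tensor R M N)"
  shows "tensor_map R M'' N g id (tensor_map R M' N f id t) = tensor_map R M'' N h id t"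
proof -
  interpret MN: tensor_factors R S M N using M N by (rule tensor_factors.intro)
  interpret M''N: tensor_factors R S M'' N using M'' N by (rule tensor_factors.intro)
  have h': "right_linear R M M'' h"
    by (rule right_linear_cong[OF M right_linear_comp[OF f g] h])
  note f' = tensor_map_right_linear[OF M N M' N f bilinear_map_id]
    and g' = tensor_map_right_linear[OF M' N M'' N g bilinear_map_id]
  show ?thesis
    by (rule MN.tensor_right_linear_eqI[OF M''N.tensor_right_module right_linear_comp[OF f' g']
          tensor_map_right_linear[OF M N M'' N h' bilinear_map_id] _ t])
      (simp add: tensor_map_el[OF M N M' N f bilinear_map_id] tensor_map_el[OF M' N M'' N g bilinear_map_id]
        tensor_map_el[OF M N M'' N h' bilinear_map_id] right_linear_closed[OF f] h)
qed

lemma comodule_right_module: "comodule G A C M \<Longrightarrow> right_module A M"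
  by (rule comodule.axioms(2))

lemma comod_homD:
  assumes "f \<in> comod_hom G A C M N"
  shows "f \<in> rmod_hom A M N" "right_linear A M N f"
    "\<And>\<alpha> m. \<lbrakk>\<alpha> \<in> carrier G; m \<in> carrier M\<rbrakk>
      \<Longrightarrow> tensor_map A N (ccomp C \<alpha>) f id (coact M \<alpha> m) = coact N \<alpha> (f m)"
  using assms by (simp_all add: comod_hom_def rmod_hom_def)

lemma comod_hom_id:
  assumes "comodule G A C M"
  shows "(\<lambda>m\<in>carrier M. m) \<in> comod_hom G A C M M"
proof -
  interpret comodule G A C M by fact
  have M: "right_module A M" by (rule comodule_right_module[OF assms])
  have hom: "(\<lambda>m\<in>carrier M. m) \<in> rmod_hom A M M"
    by (rule rmod_hom_restrict[OF M right_linear_id])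
  show ?thesis
    using hom right_linear_closed[OF coact_linear]
    by (simp add: comod_hom_def tensor_map_id[OF M comp_bimodule rmod_hom_right_linear[OF hom]])
qed

lemma comod_hom_compose:
  assumes "comodule G A C U" "comodule G A C V" "comodule G A C W"
    and f: "f \<in> comod_hom G A C U V" and g: "g \<in> comod_hom G A C V W"
  shows "compose (carrier U) g f \<in> comod_hom G A C U W"
proof -
  interpret U: comodule G A C U by fact
  note modules = assms(1-3)[THEN comodule_right_module]
  note f = comod_homD[OF f]
  note g = comod_homD[OF g]
  have "tensor_map A W (ccomp C \<alpha>) (compose (carrier U) g f) id (coact U \<alpha> m) =
      coact W \<alpha> (compose (carrier U) g f m)" if "\<alpha> \<in> carrier G" "m \<in> carrier U" for \<alpha> m
    using tensor_map_comp[OF modules(1) U.comp_bimodule modules(2,3) f(2) g(2), of \<alpha> "compose (carrier U) g f" "coact U \<alpha> m"]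
      that right_linear_closed[OF f(2)] right_linear_closed[OF U.coact_linear]
    by (simp add: f(3) g(3) compose_eq)
  then show ?thesis
    using rmod_hom_compose[OF modules(1) f(1) g(1)] by (simp add: comod_hom_def)
qed

lemma category_comod_cat: "category (comod_cat G A C)"
proof
  fix U V W f g
  assume *: "U \<in> Ob (comod_cat G A C)" "V \<in> Ob (comod_cat G A C)" "f \<in> Hom (comod_cat G A C) U V"
  then show "Cmp (comod_cat G A C) U f (Idm (comod_cat G A C) U) = f"
    "Cmp (comod_cat G A C) U (Idm (comod_cat G A C) V) f = f"
    using rmod_hom_PiE[of f A U V]
    by (auto simp: comod_cat_def comod_hom_def compose_Id Id_compose PiE_def)
  show "Cmp (comod_cat G A C) U g f \<in> Hom (comod_cat G A C) U W"
    if "g \<in> Hom (comod_cat G A C) V W" "W \<in> Ob (comod_cat G A C)"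
    using * that comod_hom_compose[of G A C U V W f g] by (simp add: comod_cat_def)
next
  fix Z U V W f g h
  assume "f \<in> Hom (comod_cat G A C) Z U" "Z \<in> Ob (comod_cat G A C)"
  then show "Cmp (comod_cat G A C) Z (Cmp (comod_cat G A C) U h g) f =
      Cmp (comod_cat G A C) Z h (Cmp (comod_cat G A C) Z g f)"
    using rmod_hom_PiE[of f A Z U]
    by (simp add: comod_cat_def comod_hom_def compose_assoc[of f _ "carrier U"] PiE_def)
next
  fix U assume "U \<in> Ob (comod_cat G A C)"
  then show "Idm (comod_cat G A C) U \<in> Hom (comod_cat G A C) U U"
    using comod_hom_id[of G A C U] by (simp add: comod_cat_def)
qed

lemma gcomod_homD:
  assumes "f \<in> gcomod_hom G A C M N"
  shows "f \<in> extensional (carrier G)"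
    "\<And>\<alpha>. \<alpha> \<in> carrier G \<Longrightarrow> f \<alpha> \<in> rmod_hom A (gcomp M \<alpha>) (gcomp N \<alpha>)"
    "\<And>\<alpha>. \<alpha> \<in> carrier G \<Longrightarrow> right_linear A (gcomp M \<alpha>) (gcomp N \<alpha>) (f \<alpha>)"
    "\<And>\<alpha> \<beta> m. \<lbrakk>\<alpha> \<in> carrier G; \<beta> \<in> carrier G; m \<in> carrier (gcomp M (\<alpha> \<otimes>\<^bsub>G\<^esub> \<beta>))\<rbrakk>
      \<Longrightarrow> tensor_map A (gcomp N \<alpha>) (ccomp C \<beta>) (f \<alpha>) id (gcoact M \<alpha> \<beta> m) =
          gcoact N \<alpha> \<beta> (f (\<alpha> \<otimes>\<^bsub>G\<^esub> \<beta>) m)"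
  using assms by (auto simp: gcomod_hom_def rmod_hom_def PiE_def Pi_def)

lemma gcomod_homI:
  assumes "f \<in> extensional (carrier G)"
    and "\<And>\<alpha>. \<alpha> \<in> carrier G \<Longrightarrow> f \<alpha> \<in> rmod_hom A (gcomp M \<alpha>) (gcomp N \<alpha>)"
    and "\<And>\<alpha> \<beta> m. \<lbrakk>\<alpha> \<in> carrier G; \<beta> \<in> carrier G; m \<in> carrier (gcomp M (\<alpha> \<otimes>\<^bsub>G\<^esub> \<beta>))\<rbrakk>
      \<Longrightarrow> tensor_map A (gcomp N \<alpha>) (ccomp C \<beta>) (f \<alpha>) id (gcoact M \<alpha> \<beta> m) =
          gcoact N \<alpha> \<beta> (f (\<alpha> \<otimes>\<^bsub>G\<^esub> \<beta>) m)"
  shows "f \<in> gcomod_hom G A C M N"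
  using assms by (simp add: gcomod_hom_def PiE_def)

lemma gcomod_hom_id:
  assumes "gcomodule G A C M"
  shows "(\<lambda>\<alpha>\<in>carrier G. \<lambda>m\<in>carrier (gcomp M \<alpha>). m) \<in> gcomod_hom G A C M M"
proof (rule gcomod_homI)
  interpret gcomodule G A C M by fact
  have hom: "(\<lambda>m\<in>carrier (gcomp M \<alpha>). m) \<in> rmod_hom A (gcomp M \<alpha>) (gcomp M \<alpha>)"
    if "\<alpha> \<in> carrier G" for \<alpha>
    by (rule rmod_hom_restrict[OF gcomp_module[OF that] right_linear_id])
  then show "(\<lambda>\<alpha>\<in>carrier G. \<lambda>m\<in>carrier (gcomp M \<alpha>). m) \<alpha> \<in> rmod_hom A (gcomp M \<alpha>) (gcomp M \<alpha>)"
    if "\<alpha> \<in> carrier G" for \<alpha>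
    using that by simp
  fix \<alpha> \<beta> m assume *: "\<alpha> \<in> carrier G" "\<beta> \<in> carrier G" "m \<in> carrier (gcomp M (\<alpha> \<otimes>\<^bsub>G\<^esub> \<beta>))"
  then show "tensor_map A (gcomp M \<alpha>) (ccomp C \<beta>) ((\<lambda>\<alpha>\<in>carrier G. \<lambda>m\<in>carrier (gcomp M \<alpha>). m) \<alpha>) id
      (gcoact M \<alpha> \<beta> m) =
      gcoact M \<alpha> \<beta> ((\<lambda>\<alpha>\<in>carrier G. \<lambda>m\<in>carrier (gcomp M \<alpha>). m) (\<alpha> \<otimes>\<^bsub>G\<^esub> \<beta>) m)"
    using right_linear_closed[OF gcoact_linear]
    by (simp add: tensor_map_id[OF gcomp_module comp_bimodule rmod_hom_right_linear[OF hom]])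
qed simp

lemma gcomod_hom_compose:
  assumes "gcomodule G A C U" "gcomodule G A C V" "gcomodule G A C W"
    and f: "f \<in> gcomod_hom G A C U V" and g: "g \<in> gcomod_hom G A C V W"
  shows "gcomod_compose G U g f \<in> gcomod_hom G A C U W"
proof (rule gcomod_homI)
  interpret U: gcomodule G A C U by fact
  interpret V: gcomodule G A C V by fact
  interpret W: gcomodule G A C W by fact
  note f = gcomod_homD[OF f]
  note g = gcomod_homD[OF g]
  show "gcomod_compose G U g f \<alpha> \<in> rmod_hom A (gcomp U \<alpha>) (gcomp W \<alpha>)" if "\<alpha> \<in> carrier G" for \<alpha>
    using that rmod_hom_compose[OF U.gcomp_module f(2) g(2)] by (simp add: gcomod_compose_def)
  show "tensor_map A (gcomp W \<alpha>) (ccomp C \<beta>) (gcomod_compose G U g f \<alpha>) id (gcoact U \<alpha> \<beta> m) =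
      gcoact W \<alpha> \<beta> (gcomod_compose G U g f (\<alpha> \<otimes>\<^bsub>G\<^esub> \<beta>) m)"
    if "\<alpha> \<in> carrier G" "\<beta> \<in> carrier G" "m \<in> carrier (gcomp U (\<alpha> \<otimes>\<^bsub>G\<^esub> \<beta>))" for \<alpha> \<beta> m
    using tensor_map_comp[OF U.gcomp_module U.comp_bimodule V.gcomp_module W.gcomp_module f(3) g(3),
        of \<alpha> \<beta> "gcomod_compose G U g f \<alpha>" "gcoact U \<alpha> \<beta> m"]
      that right_linear_closed[OF f(3)] right_linear_closed[OF U.gcoact_linear]
    by (simp add: f(4) g(4) gcomod_compose_def compose_eq)
qed (simp add: gcomod_compose_def)

lemma category_gcomod_cat: "category (gcomod_cat G A C)"
proof
  fix U V W f g
  assume *: "U \<in> Ob (gcomod_cat G A C)" "V \<in> Ob (gcomod_cat G A C)" "f \<in> Hom (gcomod_cat G A C) U V"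
  have f: "f \<in> extensional (carrier G)"
    "\<And>\<alpha>. \<alpha> \<in> carrier G \<Longrightarrow> f \<alpha> \<in> carrier (gcomp U \<alpha>) \<rightarrow> carrier (gcomp V \<alpha>)"
    "\<And>\<alpha>. \<alpha> \<in> carrier G \<Longrightarrow> f \<alpha> \<in> extensional (carrier (gcomp U \<alpha>))"
    using *(3) gcomod_homD(1)[of f G A C U V] rmod_hom_PiE[OF gcomod_homD(2)[of f G A C U V]]
    by (simp_all add: gcomod_cat_def PiE_def)
  show "Cmp (gcomod_cat G A C) U f (Idm (gcomod_cat G A C) U) = f"
    by (rule extensionalityI[of _ "carrier G"])
      (use f in \<open>simp_all add: gcomod_cat_def gcomod_compose_def compose_Id[OF f(2,3)]\<close>)
  show "Cmp (gcomod_cat G A C) U (Idm (gcomod_cat G A C) V) f = f"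
    by (rule extensionalityI[of _ "carrier G"])
      (use f in \<open>simp_all add: gcomod_cat_def gcomod_compose_def Id_compose[OF f(2,3)]\<close>)
  show "Cmp (gcomod_cat G A C) U g f \<in> Hom (gcomod_cat G A C) U W"
    if "g \<in> Hom (gcomod_cat G A C) V W" "W \<in> Ob (gcomod_cat G A C)"
    using * that gcomod_hom_compose[of G A C U V W f g] by (simp add: gcomod_cat_def)
next
  fix Z U V W f g h
  assume "f \<in> Hom (gcomod_cat G A C) Z U"
  then have f: "f \<alpha> \<in> carrier (gcomp Z \<alpha>) \<rightarrow> carrier (gcomp U \<alpha>)" if "\<alpha> \<in> carrier G" for \<alpha>
    using that rmod_hom_PiE[OF gcomod_homD(2)] by (fastforce simp: gcomod_cat_def PiE_def)
  show "Cmp (gcomod_cat G A C) Z (Cmp (gcomod_cat G A C) U h g) f =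
      Cmp (gcomod_cat G A C) Z h (Cmp (gcomod_cat G A C) Z g f)"
    unfolding gcomod_cat_def gcomod_compose_def category.simps
  proof (intro restrict_ext)
    fix \<alpha> assume "\<alpha> \<in> carrier G"
    then show "compose (carrier (gcomp Z \<alpha>)) ((\<lambda>\<alpha>\<in>carrier G. compose (carrier (gcomp U \<alpha>)) (h \<alpha>) (g \<alpha>)) \<alpha>) (f \<alpha>) =
        compose (carrier (gcomp Z \<alpha>)) (h \<alpha>) ((\<lambda>\<alpha>\<in>carrier G. compose (carrier (gcomp Z \<alpha>)) (g \<alpha>) (f \<alpha>)) \<alpha>)"
      using compose_assoc[OF f, of \<alpha> "h \<alpha>" "g \<alpha>"] by simp
  qed
next
  fix U assume "U \<in> Ob (gcomod_cat G A C)"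
  then show "Idm (gcomod_cat G A C) U \<in> Hom (gcomod_cat G A C) U U"
    using gcomod_hom_id[of G A C U] by (simp add: gcomod_cat_def)
qed

section \<open>Families of copies of a comodule\<close>

lemma cat_functor_comp:
  assumes "cat_functor \<C> \<D> H" "cat_functor \<D> \<E> K"
  shows "cat_functor \<C> \<E> (comp_functor K H)"
proof -
  interpret H: cat_functor \<C> \<D> H by fact
  interpret K: cat_functor \<D> \<E> K by fact
  show ?thesis
    by unfold_locales
      (simp_all add: comp_functor_def H.omap_Ob H.amap_Hom H.amap_Idm H.amap_Cmp
        K.omap_Ob K.amap_Hom K.amap_Idm K.amap_Cmp)
qed

lemma gcomodule_G1:
  assumes "comodule G A C M"
  shows "gcomodule G A C (omap (G1 G) M)"
proof -
  interpret comodule G A C M by fact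
  have M: "right_module A M" by (rule comodule_right_module[OF assms])
  show ?thesis
    by (intro gcomodule.intro[OF group_coring_axioms] gcomodule_axioms.intro)
      (simp_all add: G1_def right_module_truncate[OF M] coact_linear coact_coassociative coact_counit)
qed

lemma cat_functor_G1: "cat_functor (comod_cat G A C) (gcomod_cat G A C) (G1 G)"
proof (rule cat_functor.intro[OF category_comod_cat category_gcomod_cat], unfold_locales)
  fix U V W f g
  assume "U \<in> Ob (comod_cat G A C)"
  then have U: "comodule G A C U" by (simp add: comod_cat_def)
  interpret comodule G A C U by (rule U)
  show "omap (G1 G) U \<in> Ob (gcomod_cat G A C)"
    using gcomodule_G1[OF U] by (simp add: gcomod_cat_def)
  show "amap (G1 G) U U (Idm (comod_cat G A C) U) = Idm (gcomod_cat G A C) (omap (G1 G) U)"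
    by (simp add: G1_def comod_cat_def gcomod_cat_def)
  show "amap (G1 G) U W (Cmp (comod_cat G A C) U g f) =
      Cmp (gcomod_cat G A C) (omap (G1 G) U) (amap (G1 G) V W g) (amap (G1 G) U V f)"
    by (auto simp: G1_def comod_cat_def gcomod_cat_def gcomod_compose_def intro!: restrict_ext)
  assume "f \<in> Hom (comod_cat G A C) U V"
  then have f: "f \<in> comod_hom G A C U V" by (simp add: comod_cat_def)
  show "amap (G1 G) U V f \<in> Hom (gcomod_cat G A C) (omap (G1 G) U) (omap (G1 G) V)"
    using comod_homD[OF f] by (auto simp: G1_def gcomod_cat_def intro!: gcomod_homI)
qed

section \<open>Induced modules over a coring with a grouplike family\<close>

locale grouplike_coring = group_coring G A C
  for G :: "'g monoid" and A :: "'a ring" and C :: "('g, 'a, 'c) group_coring" +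
  fixes x :: "'g \<Rightarrow> 'c" and B :: "'b ring" and i :: "'b \<Rightarrow> 'a"
  assumes grouplike: "grouplike_family G A C x"
    and base_ring: "ring B"
    and base_hom: "i \<in> ring_hom B (coinvariant_ring G A C x)"
begin

abbreviation "A\<^sub>B \<equiv> ring_bimodule i A"
abbreviation "induced N \<equiv> tensor B N A\<^sub>B"
abbreviation "unit_el N n \<equiv> tensor_el B N A\<^sub>B n \<one>\<^bsub>A\<^esub>"

lemma x_closed: "\<alpha> \<in> carrier G \<Longrightarrow> x \<alpha> \<in> carrier (ccomp C \<alpha>)"
  using grouplike by (simp add: grouplike_family_def)

lemma comult_x:
  "\<lbrakk>\<alpha> \<in> carrier G; \<beta> \<in> carrier G\<rbrakk> \<Longrightarrow>
    comult C \<alpha> \<beta> (x (\<alpha> \<otimes>\<^bsub>G\<^esub> \<beta>)) = tensor_el A (ccomp C \<alpha>) (ccomp C \<beta>) (x \<alpha>) (x \<beta>)"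
  using grouplike by (simp add: grouplike_family_def)

lemma counit_x: "counit C (x \<one>\<^bsub>G\<^esub>) = \<one>\<^bsub>A\<^esub>"
  using grouplike by (simp add: grouplike_family_def)

lemma i_closed: "b \<in> carrier B \<Longrightarrow> i b \<in> carrier A"
  using ring_hom_closed[OF base_hom] by (simp add: coinvariant_ring_def)

lemma i_hom: "i \<in> ring_hom B A"
  using base_hom by (auto simp: ring_hom_def coinvariant_ring_def)

lemma x_central:
  "\<lbrakk>b \<in> carrier B; \<alpha> \<in> carrier G\<rbrakk> \<Longrightarrow> lact (ccomp C \<alpha>) (i b) (x \<alpha>) = ract (ccomp C \<alpha>) (x \<alpha>) (i b)"
  using ring_hom_closed[OF base_hom] by (simp add: coinvariant_ring_def)

lemma base_bimodule: "bimodule B A A\<^sub>B"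
  by (rule bimodule_ring_bimodule[OF base_ring A.ring_axioms i_hom])

lemma ring_bimodule_simps:
  "carrier (ring_bimodule f A) = carrier A" "ract (ring_bimodule f A) = monoid.mult A"
  "lact (ring_bimodule f A) = (\<lambda>r a. f r \<otimes>\<^bsub>A\<^esub> a)" "ring.add (ring_bimodule f A) = ring.add A"
  by (simp_all add: ring_bimodule_def)

lemma induced_factors: "right_module B N \<Longrightarrow> tensor_factors B A N A\<^sub>B"
  by (rule tensor_factors.intro[OF _ base_bimodule])

lemma induced_right_module: "right_module B N \<Longrightarrow> right_module A (induced N)"
  by (rule tensor_factors.tensor_right_module[OF induced_factors])

lemma unit_el_closed: "\<lbrakk>right_module B N; n \<in> carrier N\<rbrakk> \<Longrightarrow> unit_el N n \<in> carrier (induced N)"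
  by (rule tensor_factors.el_closed[OF induced_factors]) (simp_all add: ring_bimodule_simps)

lemma unit_el_add:
  "\<lbrakk>right_module B N; n \<in> carrier N; n' \<in> carrier N\<rbrakk>
    \<Longrightarrow> unit_el N (n \<oplus>\<^bsub>N\<^esub> n') = unit_el N n \<oplus>\<^bsub>induced N\<^esub> unit_el N n'"
  by (rule tensor_factors.el_add_left[OF induced_factors]) (simp_all add: ring_bimodule_simps)

lemma ract_unit_el:
  assumes "right_module B N" "n \<in> carrier N" "a \<in> carrier A"
  shows "ract (induced N) (unit_el N n) a = tensor_el B N A\<^sub>B n a"
  using tensor_factors.ract_el[OF induced_factors[OF assms(1)], of n "\<one>\<^bsub>A\<^esub>" a] assms
  by (simp add: ring_bimodule_simps)

lemma unit_el_ract:
  assumes "right_module B N" "n \<in> carrier N" "b \<in> carrier B"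
  shows "unit_el N (ract N n b) = ract (induced N) (unit_el N n) (i b)"
  using tensor_factors.el_balanced[OF induced_factors[OF assms(1)], of n b "\<one>\<^bsub>A\<^esub>"] assms
  by (simp add: ring_bimodule_simps ract_unit_el i_closed)

text \<open>
  Since \<open>n \<otimes> a = (n \<otimes> 1) a\<close>, the elements \<open>n \<otimes> 1\<close> generate \<open>N \<otimes>\<^sub>B A\<close> as a right \<open>A\<close>-module.
\<close>

lemma induced_eqI:
  assumes N: "right_module B N" and P: "right_module A P"
    and f: "right_linear A (induced N) P f" and g: "right_linear A (induced N) P g"
    and eq: "\<And>n. n \<in> carrier N \<Longrightarrow> f (unit_el N n) = g (unit_el N n)"
    and t: "t \<in> carrier (induced N)"
  shows "f t = g t"
proof (rule tensor_factors.tensor_right_linear_eqI[OF induced_factors[OF N] P f g _ t])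
  fix n a assume n: "n \<in> carrier N" and a: "a \<in> carrier A\<^sub>B"
  then have a: "a \<in> carrier A" by (simp add: ring_bimodule_simps)
  show "f (tensor_el B N A\<^sub>B n a) = g (tensor_el B N A\<^sub>B n a)"
    unfolding ract_unit_el[OF N n a, symmetric]
    using right_linear_ract[OF f unit_el_closed[OF N n] a] right_linear_ract[OF g unit_el_closed[OF N n] a]
    by (simp add: eq[OF n])
qed

section \<open>Induced comodules\<close>

abbreviation "F\<^sub>6 \<equiv> F6_obj A C x B i"

lemma F6_obj_truncate: "right_module.truncate (F\<^sub>6 N) = induced N"
  by (simp add: F6_obj_def Let_def right_module.truncate_def)

lemma F6_obj_simps [simp]:
  "carrier (F\<^sub>6 N) = carrier (induced N)"
  "tensor A (F\<^sub>6 N) P = tensor A (induced N) P"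
  "tensor_el A (F\<^sub>6 N) P = tensor_el A (induced N) P"
  "tensor_map A (F\<^sub>6 N) P = tensor_map A (induced N) P"
  "tensor_assoc A (F\<^sub>6 N) P Q = tensor_assoc A (induced N) P Q"
  "right_unitor (F\<^sub>6 N) = right_unitor (induced N)"
  "right_linear A (F\<^sub>6 N) M f = right_linear A (induced N) M f"
  "right_linear A M (F\<^sub>6 N) g = right_linear A M (induced N) g"
  "rmod_hom A (F\<^sub>6 N) M = rmod_hom A (induced N) M"
  "rmod_hom A M (F\<^sub>6 N) = rmod_hom A M (induced N)"
  unfolding F6_obj_truncate[symmetric] by simp_all

text \<open>
  The formula \<open>n \<otimes> a \<mapsto> (n \<otimes> 1) \<otimes> x\<^sub>\<alpha> a\<close> respects \<open>nb \<otimes> a = n \<otimes> ba\<close> because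
  \<open>(nb \<otimes> 1) \<otimes> x\<^sub>\<alpha> a = (n \<otimes> 1) \<otimes> i(b) x\<^sub>\<alpha> a = (n \<otimes> 1) \<otimes> x\<^sub>\<alpha> i(b) a\<close>, where the last step is the
  coinvariance of \<open>i(b)\<close>.
\<close>

lemma
  assumes N: "right_module B N" and \<alpha>: "\<alpha> \<in> carrier G"
  shows F6_coact_linear:
      "right_linear A (induced N) (tensor A (induced N) (ccomp C \<alpha>)) (coact (F\<^sub>6 N) \<alpha>)"
    and F6_coact_unit: "\<And>n. n \<in> carrier N \<Longrightarrow>
      coact (F\<^sub>6 N) \<alpha> (unit_el N n) = tensor_el A (induced N) (ccomp C \<alpha>) (unit_el N n) (x \<alpha>)"
proof -
  interpret C\<^sub>\<alpha>: bimodule A A "ccomp C \<alpha>" by (rule comp_bimodule[OF \<alpha>])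
  interpret N: tensor_factors B A N A\<^sub>B by (rule induced_factors[OF N])
  interpret T: tensor_factors A A "induced N" "ccomp C \<alpha>"
    by (rule tensor_factors.intro[OF induced_right_module[OF N] comp_bimodule[OF \<alpha>]])
  define \<beta> where "\<beta> n a = T.el (unit_el N n) (ract (ccomp C \<alpha>) (x \<alpha>) a)" for n a
  have coact: "coact (F\<^sub>6 N) \<alpha> = tensor_lift T.T \<beta>"
    by (simp add: F6_obj_def Let_def \<beta>_def[abs_def])
  note closed = unit_el_closed[OF N] x_closed[OF \<alpha>] C\<^sub>\<alpha>.ract_closed
  have balanced: "balanced_map B N A\<^sub>B T.T \<beta>"
  proof (intro balanced_mapI add_homI)
    fix n b a assume n: "n \<in> carrier N" and b: "b \<in> carrier B" and "a \<in> carrier A\<^sub>B"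
    then have a: "a \<in> carrier A" by (simp add: ring_bimodule_simps)
    note ib = i_closed[OF b]
    have "\<beta> (ract N n b) a = T.el (ract (induced N) (unit_el N n) (i b)) (ract (ccomp C \<alpha>) (x \<alpha>) a)"
      by (simp add: \<beta>_def unit_el_ract[OF N n b])
    also have "\<dots> = T.el (unit_el N n) (lact (ccomp C \<alpha>) (i b) (ract (ccomp C \<alpha>) (x \<alpha>) a))"
      using n a ib by (intro T.el_balanced closed)
    also have "lact (ccomp C \<alpha>) (i b) (ract (ccomp C \<alpha>) (x \<alpha>) a) = ract (ccomp C \<alpha>) (x \<alpha>) (i b \<otimes>\<^bsub>A\<^esub> a)"
      using a ib by (simp add: C\<^sub>\<alpha>.lact_ract[symmetric] C\<^sub>\<alpha>.ract_mult closed x_central[OF b \<alpha>])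
    finally show "\<beta> (ract N n b) a = \<beta> n (lact A\<^sub>B b a)"
      by (simp add: \<beta>_def ring_bimodule_simps)
  qed (simp_all add: \<beta>_def ring_bimodule_simps T.el_closed T.el_add_left T.el_add_right closed
      unit_el_add[OF N] C\<^sub>\<alpha>.ract_add)
  show "right_linear A (induced N) T.T (coact (F\<^sub>6 N) \<alpha>)"
    unfolding coact
    by (rule N.tensor_lift_right_linear[OF T.tensor_right_module balanced])
      (simp add: \<beta>_def ring_bimodule_simps T.ract_el closed C\<^sub>\<alpha>.ract_mult)
  show "coact (F\<^sub>6 N) \<alpha> (unit_el N n) = T.el (unit_el N n) (x \<alpha>)" if "n \<in> carrier N" for n
    unfolding coact
    using N.tensor_lift_el[OF T.tensor_abelian_group balanced that, of "\<one>\<^bsub>A\<^esub>"]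
    by (simp add: \<beta>_def ring_bimodule_simps C\<^sub>\<alpha>.ract_one closed)
qed

text \<open>
  On \<open>n \<otimes> 1\<close> both sides of coassociativity are \<open>(n \<otimes> 1) \<otimes> (x\<^sub>\<alpha> \<otimes> x\<^sub>\<beta>)\<close>, and the counit gives
  \<open>(n \<otimes> 1) \<epsilon>(x\<^sub>e) = n \<otimes> 1\<close>.
\<close>

lemma comodule_F6:
  assumes N: "right_module B N"
  shows "comodule G A C (F\<^sub>6 N)"
proof (intro comodule.intro[OF group_coring_axioms] comodule_axioms.intro)
  note T = induced_right_module[OF N]
  note coact_linear = F6_coact_linear[OF N] and coact_unit = F6_coact_unit[OF N]
  note unit_closed = unit_el_closed[OF N]
  have id_linear: "right_linear A (induced N) (induced N) id"
    using right_linear_id unfolding id_def .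
  show "right_module A (F\<^sub>6 N)"
    using T by (rule right_module_cong) (simp_all add: F6_obj_def Let_def)
  show "right_linear A (F\<^sub>6 N) (tensor A (F\<^sub>6 N) (ccomp C \<alpha>)) (coact (F\<^sub>6 N) \<alpha>)"
    if "\<alpha> \<in> carrier G" for \<alpha>
    using coact_linear[OF that] by simp
  show "tensor_map A (F\<^sub>6 N) (tensor_bimodule A (ccomp C \<alpha>) (ccomp C \<beta>)) id (comult C \<alpha> \<beta>)
      (coact (F\<^sub>6 N) (\<alpha> \<otimes>\<^bsub>G\<^esub> \<beta>) t) =
      tensor_assoc A (F\<^sub>6 N) (ccomp C \<alpha>) (ccomp C \<beta>)
        (tensor_map A (tensor A (F\<^sub>6 N) (ccomp C \<alpha>)) (ccomp C \<beta>) (coact (F\<^sub>6 N) \<alpha>) id (coact (F\<^sub>6 N) \<beta> t))"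
    if \<alpha>: "\<alpha> \<in> carrier G" and \<beta>: "\<beta> \<in> carrier G" and t: "t \<in> carrier (F\<^sub>6 N)" for \<alpha> \<beta> t
  proof -
    have \<alpha>\<beta>: "\<alpha> \<otimes>\<^bsub>G\<^esub> \<beta> \<in> carrier G" using \<alpha> \<beta> by simp
    note C = comp_bimodule
    note CC = bimodule_tensor_bimodule[OF C[OF \<alpha>] C[OF \<beta>]]
    have TC: "right_module A (tensor A (induced N) (ccomp C \<alpha>))"
      by (rule tensor_factors.tensor_right_module[OF tensor_factors.intro[OF T C[OF \<alpha>]]])
    have TCC: "right_module A (tensor A (induced N) (tensor_bimodule A (ccomp C \<alpha>) (ccomp C \<beta>)))"
      by (rule tensor_factors.tensor_right_module[OF tensor_factors.intro[OF T CC]])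
    note comult_args = T C[OF \<alpha>\<beta>] T CC id_linear comult_bilinear[OF \<alpha> \<beta>]
    note coact_args = T C[OF \<beta>] TC C[OF \<beta>] coact_linear[OF \<alpha>] bilinear_map_id
    note assoc_args = T C[OF \<alpha>] C[OF \<beta>]
    have "tensor_map A (induced N) (tensor_bimodule A (ccomp C \<alpha>) (ccomp C \<beta>)) id (comult C \<alpha> \<beta>)
        (coact (F\<^sub>6 N) (\<alpha> \<otimes>\<^bsub>G\<^esub> \<beta>) t) =
      tensor_assoc A (induced N) (ccomp C \<alpha>) (ccomp C \<beta>)
        (tensor_map A (tensor A (induced N) (ccomp C \<alpha>)) (ccomp C \<beta>) (coact (F\<^sub>6 N) \<alpha>) id (coact (F\<^sub>6 N) \<beta> t))"
    proof (rule induced_eqI[OF N TCC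
          right_linear_comp[OF coact_linear[OF \<alpha>\<beta>] tensor_map_right_linear[OF comult_args]]
          right_linear_comp[OF right_linear_comp[OF coact_linear[OF \<beta>] tensor_map_right_linear[OF coact_args]]
            tensor_assoc_right_linear[OF assoc_args]]])
      fix n assume n: "n \<in> carrier N"
      show "tensor_map A (induced N) (tensor_bimodule A (ccomp C \<alpha>) (ccomp C \<beta>)) id (comult C \<alpha> \<beta>)
          (coact (F\<^sub>6 N) (\<alpha> \<otimes>\<^bsub>G\<^esub> \<beta>) (unit_el N n)) =
        tensor_assoc A (induced N) (ccomp C \<alpha>) (ccomp C \<beta>)
          (tensor_map A (tensor A (induced N) (ccomp C \<alpha>)) (ccomp C \<beta>) (coact (F\<^sub>6 N) \<alpha>) id
            (coact (F\<^sub>6 N) \<beta> (unit_el N n)))"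
        using n \<alpha> \<beta> \<alpha>\<beta>
        by (simp add: coact_unit tensor_map_el[OF comult_args] tensor_map_el[OF coact_args]
            tensor_assoc_el[OF assoc_args] unit_closed x_closed comult_x)
    qed (use t in simp)
    then show ?thesis by simp
  qed
  show "right_unitor (F\<^sub>6 N) (tensor_map A (F\<^sub>6 N) (ring_bimodule id A) id (counit C)
      (coact (F\<^sub>6 N) \<one>\<^bsub>G\<^esub> t)) = t" if t: "t \<in> carrier (F\<^sub>6 N)" for t
  proof -
    have A: "bimodule A A (ring_bimodule id A)"
      by (rule bimodule_ring_bimodule) (simp_all add: A.ring_axioms ring_hom_def)
    note counit_args = T comp_bimodule[OF G.one_closed] T A id_linear counit_bilinear
    have "right_unitor (induced N) (tensor_map A (induced N) (ring_bimodule id A) id (counit C)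
        (coact (F\<^sub>6 N) \<one>\<^bsub>G\<^esub> t)) = t"
    proof (rule induced_eqI[OF N T
          right_linear_comp[OF right_linear_comp[OF coact_linear[OF G.one_closed]
              tensor_map_right_linear[OF counit_args]] right_unitor_right_linear[OF T]]
          right_linear_id])
      fix n assume n: "n \<in> carrier N"
      show "right_unitor (induced N) (tensor_map A (induced N) (ring_bimodule id A) id (counit C)
          (coact (F\<^sub>6 N) \<one>\<^bsub>G\<^esub> (unit_el N n))) = unit_el N n"
        using n by (simp add: coact_unit tensor_map_el[OF counit_args] right_unitor_el[OF T]
            unit_closed x_closed counit_x right_module.ract_one[OF T])
    qed (use t in simp)
    then show ?thesis by simp
  qed
qed

lemma
  assumes N: "right_module B N" and N': "right_module B N'" and f: "f \<in> rmod_hom B N N'"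
  shows F6_amap_linear: "amap (F6 A C x B i) N N' f \<in> rmod_hom A (induced N) (induced N')"
    and F6_amap_unit: "\<And>n. n \<in> carrier N \<Longrightarrow> amap (F6 A C x B i) N N' f (unit_el N n) = unit_el N' (f n)"
proof -
  note args = N base_bimodule N' base_bimodule rmod_hom_right_linear[OF f] bilinear_map_id
  show "amap (F6 A C x B i) N N' f \<in> rmod_hom A (induced N) (induced N')"
    unfolding F6_def using rmod_hom_restrict[OF induced_right_module[OF N] tensor_map_right_linear[OF args]]
    by simp
  show "amap (F6 A C x B i) N N' f (unit_el N n) = unit_el N' (f n)" if "n \<in> carrier N" for n
    unfolding F6_def using that tensor_map_el[OF args that, of "\<one>\<^bsub>A\<^esub>"]
    by (simp add: unit_el_closed[OF N] ring_bimodule_simps)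
qed

lemma F6_amap_comod_hom:
  assumes N: "right_module B N" and N': "right_module B N'" and f: "f \<in> rmod_hom B N N'"
  shows "amap (F6 A C x B i) N N' f \<in> comod_hom G A C (F\<^sub>6 N) (F\<^sub>6 N')"
proof -
  let ?f = "amap (F6 A C x B i) N N' f"
  note f_hom = F6_amap_linear[OF assms]
  note f_linear = rmod_hom_right_linear[OF f_hom]
  have "tensor_map A (induced N') (ccomp C \<alpha>) ?f id (coact (F\<^sub>6 N) \<alpha> t) = coact (F\<^sub>6 N') \<alpha> (?f t)"
    if \<alpha>: "\<alpha> \<in> carrier G" and t: "t \<in> carrier (induced N)" for \<alpha> t
  proof -
    note C = comp_bimodule[OF \<alpha>]
    note args = induced_right_module[OF N] C induced_right_module[OF N'] C f_linear bilinear_map_id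
    have TC: "right_module A (tensor A (induced N') (ccomp C \<alpha>))"
      by (rule tensor_factors.tensor_right_module[OF tensor_factors.intro[OF induced_right_module[OF N'] C]])
    show ?thesis
      by (rule induced_eqI[OF N TC
            right_linear_comp[OF F6_coact_linear[OF N \<alpha>] tensor_map_right_linear[OF args]]
            right_linear_comp[OF f_linear F6_coact_linear[OF N' \<alpha>]] _ t])
        (simp add: F6_coact_unit[OF N \<alpha>] F6_coact_unit[OF N' \<alpha>] tensor_map_el[OF args]
          F6_amap_unit[OF assms] unit_el_closed[OF N] x_closed[OF \<alpha>]
          right_linear_closed[OF rmod_hom_right_linear[OF f]])
  qed
  then show ?thesis
    using f_hom by (simp add: comod_hom_def)
qed

lemma cat_functor_F6: "cat_functor (rmod_cat B) (comod_cat G A C) (F6 A C x B i)"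
proof (rule cat_functor.intro[OF category_rmod_cat category_comod_cat], unfold_locales)
  fix U V W f g
  assume "U \<in> Ob (rmod_cat B)"
  then have U: "right_module B U" by (simp add: rmod_cat_def)
  show "omap (F6 A C x B i) U \<in> Ob (comod_cat G A C)"
    using comodule_F6[OF U] by (simp add: F6_def comod_cat_def)
  have "right_linear B U U (\<lambda>m\<in>carrier U. m)"
    by (rule rmod_hom_right_linear[OF rmod_hom_restrict[OF U right_linear_id]])
  then show "amap (F6 A C x B i) U U (Idm (rmod_cat B) U) = Idm (comod_cat G A C) (omap (F6 A C x B i) U)"
    by (auto simp: F6_def rmod_cat_def comod_cat_def tensor_map_id[OF U base_bimodule] intro!: restrict_ext)
  assume "V \<in> Ob (rmod_cat B)" "f \<in> Hom (rmod_cat B) U V"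
  then have V: "right_module B V" and f: "f \<in> rmod_hom B U V" by (simp_all add: rmod_cat_def)
  show "amap (F6 A C x B i) U V f \<in> Hom (comod_cat G A C) (omap (F6 A C x B i) U) (omap (F6 A C x B i) V)"
    using F6_amap_comod_hom[OF U V f] by (simp add: comod_cat_def F6_def)
  assume "W \<in> Ob (rmod_cat B)" "g \<in> Hom (rmod_cat B) V W"
  then have W: "right_module B W" and g: "g \<in> rmod_hom B V W" by (simp_all add: rmod_cat_def)
  have "tensor_map B W A\<^sub>B (compose (carrier U) g f) id t =
      compose (carrier (induced U)) (amap (F6 A C x B i) V W g) (amap (F6 A C x B i) U V f) t"
    if t: "t \<in> carrier (induced U)" for t
  proof -
    have "tensor_map B V A\<^sub>B f id t \<in> carrier (induced V)"
      using right_linear_closed[OF rmod_hom_right_linear[OF F6_amap_linear[OF U V f]] t] t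
      by (simp add: F6_def)
    then show ?thesis
      using t tensor_map_comp[OF U base_bimodule V W rmod_hom_right_linear[OF f] rmod_hom_right_linear[OF g] _ t,
          of "compose (carrier U) g f"]
      by (simp add: F6_def compose_eq)
  qed
  then show "amap (F6 A C x B i) U W (Cmp (rmod_cat B) U g f) =
      Cmp (comod_cat G A C) (omap (F6 A C x B i) U) (amap (F6 A C x B i) V W g) (amap (F6 A C x B i) U V f)"
    by (intro extensionalityI[of _ "carrier (induced U)"]) (simp_all add: F6_def rmod_cat_def comod_cat_def)
qed

lemma cat_functor_F7: "cat_functor (rmod_cat B) (gcomod_cat G A C) (F7 G A C x B i)"
  unfolding F7_def by (rule cat_functor_comp[OF cat_functor_F6 cat_functor_G1])


section \<open>Coinvariants\<close>

abbreviation "G\<^sub>7 \<equiv> G7_obj G A C x i"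

lemma G7_memD:
  assumes "m \<in> carrier (G\<^sub>7 M)"
  shows "m \<in> extensional (carrier G)"
    "\<And>\<alpha>. \<alpha> \<in> carrier G \<Longrightarrow> m \<alpha> \<in> carrier (gcomp M \<alpha>)"
    "\<And>\<alpha> \<beta>. \<lbrakk>\<alpha> \<in> carrier G; \<beta> \<in> carrier G\<rbrakk> \<Longrightarrow>
      gcoact M \<alpha> \<beta> (m (\<alpha> \<otimes>\<^bsub>G\<^esub> \<beta>)) = tensor_el A (gcomp M \<alpha>) (ccomp C \<beta>) (m \<alpha>) (x \<beta>)"
  using assms by (auto simp: G7_obj_def PiE_def Pi_def)

lemma G7_memI:
  assumes "\<And>\<alpha>. \<alpha> \<in> carrier G \<Longrightarrow> m \<alpha> \<in> carrier (gcomp M \<alpha>)"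
    and "\<And>\<alpha> \<beta>. \<lbrakk>\<alpha> \<in> carrier G; \<beta> \<in> carrier G\<rbrakk> \<Longrightarrow>
      gcoact M \<alpha> \<beta> (m (\<alpha> \<otimes>\<^bsub>G\<^esub> \<beta>)) = tensor_el A (gcomp M \<alpha>) (ccomp C \<beta>) (m \<alpha>) (x \<beta>)"
  shows "(\<lambda>\<alpha>\<in>carrier G. m \<alpha>) \<in> carrier (G\<^sub>7 M)"
  using assms by (simp add: G7_obj_def)

lemma G7_simps:
  "m \<oplus>\<^bsub>G\<^sub>7 M\<^esub> n = (\<lambda>\<alpha>\<in>carrier G. m \<alpha> \<oplus>\<^bsub>gcomp M \<alpha>\<^esub> n \<alpha>)"
  "\<zero>\<^bsub>G\<^sub>7 M\<^esub> = (\<lambda>\<alpha>\<in>carrier G. \<zero>\<^bsub>gcomp M \<alpha>\<^esub>)"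
  "ract (G\<^sub>7 M) m b = (\<lambda>\<alpha>\<in>carrier G. ract (gcomp M \<alpha>) (m \<alpha>) (i b))"
  by (simp_all add: G7_obj_def)

lemma G7_eqI:
  assumes "m \<in> carrier (G\<^sub>7 M)" "n \<in> carrier (G\<^sub>7 M)" "\<And>\<alpha>. \<alpha> \<in> carrier G \<Longrightarrow> m \<alpha> = n \<alpha>"
  shows "m = n"
  using assms by (blast intro: extensionalityI dest: G7_memD(1))

text \<open>
  Coinvariance of a family equates two additive maps, \<open>\<rho>\<^sub>\<alpha>\<^sub>,\<^sub>\<beta>\<close> and \<open>m \<mapsto> m \<otimes> x\<^sub>\<beta>\<close>, so it passes to sums and
  negatives. For the action of \<open>b\<close> it reads \<open>\<rho>(m b) = (m \<otimes> x\<^sub>\<beta>) i(b) = m \<otimes> i(b) x\<^sub>\<beta> = m b \<otimes> x\<^sub>\<beta>\<close>.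
\<close>

lemma right_module_G7:
  assumes "gcomodule G A C M"
  shows "right_module B (G\<^sub>7 M)"
proof -
  interpret gcomodule G A C M by (rule assms)
  interpret B: ring B by (rule base_ring)
  note modules = gcomp_module and groups = right_module_abelian_group[OF gcomp_module]
  note coact_hom = right_linear_add_hom[OF gcoact_linear]
  have factors: "tensor_factors A A (gcomp M \<alpha>) (ccomp C \<beta>)"
    if "\<alpha> \<in> carrier G" "\<beta> \<in> carrier G" for \<alpha> \<beta>
    by (rule tensor_factors.intro[OF gcomp_module[OF that(1)] comp_bimodule[OF that(2)]])
  have el_hom: "(\<lambda>m. tensor_el A (gcomp M \<alpha>) (ccomp C \<beta>) m (x \<beta>))
      \<in> add_hom (gcomp M \<alpha>) (tensor A (gcomp M \<alpha>) (ccomp C \<beta>))"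
    if "\<alpha> \<in> carrier G" "\<beta> \<in> carrier G" for \<alpha> \<beta>
    using tensor_factors.el_balanced_map[OF factors[OF that]] x_closed[OF that(2)]
    by (simp add: balanced_map_def)
  have T_group: "abelian_group (tensor A (gcomp M \<alpha>) (ccomp C \<beta>))"
    if "\<alpha> \<in> carrier G" "\<beta> \<in> carrier G" for \<alpha> \<beta>
    by (rule tensor_factors.tensor_abelian_group[OF factors[OF that]])
  have closed: "\<And>\<alpha> m n. \<lbrakk>\<alpha> \<in> carrier G; m \<in> carrier (gcomp M \<alpha>); n \<in> carrier (gcomp M \<alpha>)\<rbrakk>
      \<Longrightarrow> m \<oplus>\<^bsub>gcomp M \<alpha>\<^esub> n \<in> carrier (gcomp M \<alpha>)"
    by (rule abelian_monoid.a_closed[OF abelian_group.axioms(1)[OF groups]])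
  have add_closed: "m \<oplus>\<^bsub>G\<^sub>7 M\<^esub> n \<in> carrier (G\<^sub>7 M)"
    if m: "m \<in> carrier (G\<^sub>7 M)" and n: "n \<in> carrier (G\<^sub>7 M)" for m n
    unfolding G7_simps
    using G7_memD[OF m] G7_memD[OF n]
    by (intro G7_memI) (simp_all add: closed add_hom_add[OF coact_hom] add_hom_add[OF el_hom])
  have zero_closed: "\<zero>\<^bsub>G\<^sub>7 M\<^esub> \<in> carrier (G\<^sub>7 M)"
    unfolding G7_simps
    by (intro G7_memI)
      (simp_all add: abelian_monoid.zero_closed[OF abelian_group.axioms(1)[OF groups]]
        add_hom_zero[OF groups T_group coact_hom] add_hom_zero[OF groups T_group el_hom])
  have neg_closed: "(\<lambda>\<alpha>\<in>carrier G. \<ominus>\<^bsub>gcomp M \<alpha>\<^esub> m \<alpha>) \<in> carrier (G\<^sub>7 M)"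
    if m: "m \<in> carrier (G\<^sub>7 M)" for m
    using G7_memD[OF m]
    by (intro G7_memI)
      (simp_all add: abelian_group.a_inv_closed[OF groups]
        add_hom_neg[OF groups T_group coact_hom] add_hom_neg[OF groups T_group el_hom])
  have ract_closed: "ract (G\<^sub>7 M) m b \<in> carrier (G\<^sub>7 M)"
    if m: "m \<in> carrier (G\<^sub>7 M)" and b: "b \<in> carrier B" for m b
    unfolding G7_simps
  proof (intro G7_memI)
    fix \<alpha> \<beta> assume \<alpha>: "\<alpha> \<in> carrier G"
    then show "ract (gcomp M \<alpha>) (m \<alpha>) (i b) \<in> carrier (gcomp M \<alpha>)"
      using G7_memD(2)[OF m] i_closed[OF b] by (simp add: right_module.ract_closed[OF gcomp_module])
    assume \<beta>: "\<beta> \<in> carrier G"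
    interpret T: tensor_factors A A "gcomp M \<alpha>" "ccomp C \<beta>" by (rule factors[OF \<alpha> \<beta>])
    have "gcoact M \<alpha> \<beta> (ract (gcomp M (\<alpha> \<otimes>\<^bsub>G\<^esub> \<beta>)) (m (\<alpha> \<otimes>\<^bsub>G\<^esub> \<beta>)) (i b)) = ract T.T (T.el (m \<alpha>) (x \<beta>)) (i b)"
      using \<alpha> \<beta> G7_memD[OF m] i_closed[OF b] by (simp add: right_linear_ract[OF gcoact_linear])
    also have "\<dots> = T.el (m \<alpha>) (lact (ccomp C \<beta>) (i b) (x \<beta>))"
      using \<alpha> \<beta> G7_memD(2)[OF m] i_closed[OF b] x_closed by (simp add: T.ract_el x_central[OF b])
    also have "\<dots> = T.el (ract (gcomp M \<alpha>) (m \<alpha>) (i b)) (x \<beta>)"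
      using \<alpha> \<beta> G7_memD(2)[OF m] i_closed[OF b] x_closed by (simp add: T.el_balanced)
    finally show "gcoact M \<alpha> \<beta> (ract (gcomp M (\<alpha> \<otimes>\<^bsub>G\<^esub> \<beta>)) (m (\<alpha> \<otimes>\<^bsub>G\<^esub> \<beta>)) (i b)) =
        T.el (ract (gcomp M \<alpha>) (m \<alpha>) (i b)) (x \<beta>)" .
  qed
  have "abelian_group (G\<^sub>7 M)"
  proof (rule abelian_groupI)
    fix m n k assume m: "m \<in> carrier (G\<^sub>7 M)" and n: "n \<in> carrier (G\<^sub>7 M)" and k: "k \<in> carrier (G\<^sub>7 M)"
    note D = G7_memD(2)[OF m] G7_memD(2)[OF n] G7_memD(2)[OF k]
    show "m \<oplus>\<^bsub>G\<^sub>7 M\<^esub> n \<in> carrier (G\<^sub>7 M)" by (rule add_closed[OF m n])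
    show "m \<oplus>\<^bsub>G\<^sub>7 M\<^esub> n = n \<oplus>\<^bsub>G\<^sub>7 M\<^esub> m"
      unfolding G7_simps
      by (intro restrict_ext abelian_monoid.a_comm[OF abelian_group.axioms(1)[OF groups]] D)
    show "m \<oplus>\<^bsub>G\<^sub>7 M\<^esub> n \<oplus>\<^bsub>G\<^sub>7 M\<^esub> k = m \<oplus>\<^bsub>G\<^sub>7 M\<^esub> (n \<oplus>\<^bsub>G\<^sub>7 M\<^esub> k)"
      by (rule G7_eqI[of _ M])
        (use m n k D in \<open>simp_all add: add_closed,
         simp add: G7_simps abelian_monoid.a_assoc[OF abelian_group.axioms(1)[OF groups]]\<close>)
    show "\<zero>\<^bsub>G\<^sub>7 M\<^esub> \<oplus>\<^bsub>G\<^sub>7 M\<^esub> m = m"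
      by (rule G7_eqI[of _ M])
        (use m D in \<open>simp_all add: add_closed zero_closed,
         simp add: G7_simps abelian_monoid.l_zero[OF abelian_group.axioms(1)[OF groups]]\<close>)
    have "(\<lambda>\<alpha>\<in>carrier G. \<ominus>\<^bsub>gcomp M \<alpha>\<^esub> m \<alpha>) \<oplus>\<^bsub>G\<^sub>7 M\<^esub> m = \<zero>\<^bsub>G\<^sub>7 M\<^esub>"
      by (rule G7_eqI[of _ M])
        (use m D in \<open>simp_all add: add_closed zero_closed neg_closed,
         simp add: G7_simps abelian_group.l_neg[OF groups]\<close>)
    then show "\<exists>n\<in>carrier (G\<^sub>7 M). n \<oplus>\<^bsub>G\<^sub>7 M\<^esub> m = \<zero>\<^bsub>G\<^sub>7 M\<^esub>"
      using neg_closed[OF m] by blast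
  qed (rule zero_closed)
  moreover have "right_module_axioms B (G\<^sub>7 M)"
  proof
    fix m b assume m: "m \<in> carrier (G\<^sub>7 M)" and b: "b \<in> carrier B"
    note D = G7_memD(2)[OF m] i_closed[OF b]
    show "ract (G\<^sub>7 M) m b \<in> carrier (G\<^sub>7 M)" by (rule ract_closed[OF m b])
    show "ract (G\<^sub>7 M) (m \<oplus>\<^bsub>G\<^sub>7 M\<^esub> n) b = ract (G\<^sub>7 M) m b \<oplus>\<^bsub>G\<^sub>7 M\<^esub> ract (G\<^sub>7 M) n b"
      if n: "n \<in> carrier (G\<^sub>7 M)" for n
      by (rule G7_eqI[of _ M])
        (use m b n D G7_memD(2)[OF n] in \<open>simp_all add: add_closed ract_closed,
          simp add: G7_simps right_module.add_ract[OF modules]\<close>)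
    fix c assume c: "c \<in> carrier B"
    show "ract (G\<^sub>7 M) m (b \<oplus>\<^bsub>B\<^esub> c) = ract (G\<^sub>7 M) m b \<oplus>\<^bsub>G\<^sub>7 M\<^esub> ract (G\<^sub>7 M) m c"
      by (rule G7_eqI[of _ M])
        (use m b c D i_closed[OF c] in \<open>simp_all add: add_closed ract_closed,
          simp add: G7_simps right_module.ract_add[OF modules] ring_hom_add[OF i_hom]\<close>)
    show "ract (G\<^sub>7 M) m (b \<otimes>\<^bsub>B\<^esub> c) = ract (G\<^sub>7 M) (ract (G\<^sub>7 M) m b) c"
      by (rule G7_eqI[of _ M])
        (use m b c D i_closed[OF c] in \<open>simp_all add: ract_closed,
          simp add: G7_simps right_module.ract_mult[OF modules] ring_hom_mult[OF i_hom]\<close>)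
  next
    fix m assume m: "m \<in> carrier (G\<^sub>7 M)"
    show "ract (G\<^sub>7 M) m \<one>\<^bsub>B\<^esub> = m"
      by (rule G7_eqI[of _ M])
        (use m G7_memD(2)[OF m] in \<open>simp_all add: ract_closed,
          simp add: G7_simps right_module.ract_one[OF modules] ring_hom_one[OF i_hom]\<close>)
  qed
  ultimately show ?thesis
    by (intro right_module.intro base_ring)
qed

text \<open>
  From \<open>\<rho>(f(m)) = (f \<otimes> C\<^sub>\<beta>)(\<rho>(m)) = (f \<otimes> C\<^sub>\<beta>)(m \<otimes> x\<^sub>\<beta>) = f(m) \<otimes> x\<^sub>\<beta>\<close>.
\<close>

lemma G7_amap_closed:
  assumes "gcomodule G A C M" "gcomodule G A C M'"
    and f: "f \<in> gcomod_hom G A C M M'" and m: "m \<in> carrier (G\<^sub>7 M)"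
  shows "(\<lambda>\<alpha>\<in>carrier G. f \<alpha> (m \<alpha>)) \<in> carrier (G\<^sub>7 M')"
proof (rule G7_memI)
  interpret M: gcomodule G A C M by fact
  interpret M': gcomodule G A C M' by fact
  note f = gcomod_homD[OF f] and m = G7_memD[OF m]
  show "f \<alpha> (m \<alpha>) \<in> carrier (gcomp M' \<alpha>)" if "\<alpha> \<in> carrier G" for \<alpha>
    using right_linear_closed[OF f(3) m(2)] that by simp
  fix \<alpha> \<beta> assume \<alpha>: "\<alpha> \<in> carrier G" and \<beta>: "\<beta> \<in> carrier G"
  note C = comp_bimodule[OF \<beta>]
  have "gcoact M' \<alpha> \<beta> (f (\<alpha> \<otimes>\<^bsub>G\<^esub> \<beta>) (m (\<alpha> \<otimes>\<^bsub>G\<^esub> \<beta>))) =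
      tensor_map A (gcomp M' \<alpha>) (ccomp C \<beta>) (f \<alpha>) id (gcoact M \<alpha> \<beta> (m (\<alpha> \<otimes>\<^bsub>G\<^esub> \<beta>)))"
    using \<alpha> \<beta> m(2) by (simp add: f(4))
  also have "\<dots> = tensor_el A (gcomp M' \<alpha>) (ccomp C \<beta>) (f \<alpha> (m \<alpha>)) (x \<beta>)"
    using tensor_map_el[OF M.gcomp_module[OF \<alpha>] C M'.gcomp_module[OF \<alpha>] C f(3)[OF \<alpha>] bilinear_map_id
        m(2)[OF \<alpha>] x_closed[OF \<beta>]]
    by (simp add: m(3)[OF \<alpha> \<beta>])
  finally show "gcoact M' \<alpha> \<beta> (f (\<alpha> \<otimes>\<^bsub>G\<^esub> \<beta>) (m (\<alpha> \<otimes>\<^bsub>G\<^esub> \<beta>))) =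
      tensor_el A (gcomp M' \<alpha>) (ccomp C \<beta>) (f \<alpha> (m \<alpha>)) (x \<beta>)" .
qed

lemma G7_amap_rmod_hom:
  assumes M: "gcomodule G A C M" and M': "gcomodule G A C M'" and f: "f \<in> gcomod_hom G A C M M'"
  shows "amap (G7 G A C x i) M M' f \<in> rmod_hom B (G\<^sub>7 M) (G\<^sub>7 M')"
proof -
  interpret M7: right_module B "G\<^sub>7 M" by (rule right_module_G7[OF M])
  let ?f = "\<lambda>m. \<lambda>\<alpha>\<in>carrier G. f \<alpha> (m \<alpha>)"
  note fD = gcomod_homD[OF f]
  have "right_linear B (G\<^sub>7 M) (G\<^sub>7 M') ?f"
    unfolding right_linear_def
  proof (intro conjI ballI add_homI)
    fix m assume m: "m \<in> carrier (G\<^sub>7 M)"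
    show "?f m \<in> carrier (G\<^sub>7 M')" by (rule G7_amap_closed[OF M M' f m])
    show "?f (m \<oplus>\<^bsub>G\<^sub>7 M\<^esub> n) = ?f m \<oplus>\<^bsub>G\<^sub>7 M'\<^esub> ?f n" if n: "n \<in> carrier (G\<^sub>7 M)" for n
      using G7_memD(2)[OF m] G7_memD(2)[OF n]
      by (auto simp: G7_simps add_hom_add[OF right_linear_add_hom[OF fD(3)]] intro!: restrict_ext)
    show "?f (ract (G\<^sub>7 M) m b) = ract (G\<^sub>7 M') (?f m) b" if b: "b \<in> carrier B" for b
      using G7_memD(2)[OF m] i_closed[OF b]
      by (auto simp: G7_simps right_linear_ract[OF fD(3)] intro!: restrict_ext)
  qed
  then show ?thesis
    unfolding G7_def using rmod_hom_restrict[OF M7.right_module_axioms] by simp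
qed

lemma cat_functor_G7: "cat_functor (gcomod_cat G A C) (rmod_cat B) (G7 G A C x i)"
proof (rule cat_functor.intro[OF category_gcomod_cat category_rmod_cat], unfold_locales)
  fix U V W f g
  assume "U \<in> Ob (gcomod_cat G A C)"
  then have U: "gcomodule G A C U" by (simp add: gcomod_cat_def)
  show "omap (G7 G A C x i) U \<in> Ob (rmod_cat B)"
    using right_module_G7[OF U] by (simp add: G7_def rmod_cat_def)
  show "amap (G7 G A C x i) U U (Idm (gcomod_cat G A C) U) = Idm (rmod_cat B) (omap (G7 G A C x i) U)"
    by (auto simp: G7_def gcomod_cat_def rmod_cat_def G7_memD
        intro!: restrict_ext extensionalityI[of _ "carrier G"])
  assume "V \<in> Ob (gcomod_cat G A C)" "f \<in> Hom (gcomod_cat G A C) U V"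
  then have V: "gcomodule G A C V" and f: "f \<in> gcomod_hom G A C U V" by (simp_all add: gcomod_cat_def)
  show "amap (G7 G A C x i) U V f \<in> Hom (rmod_cat B) (omap (G7 G A C x i) U) (omap (G7 G A C x i) V)"
    using G7_amap_rmod_hom[OF U V f] by (simp add: rmod_cat_def G7_def)
  show "amap (G7 G A C x i) U W (Cmp (gcomod_cat G A C) U g f) =
      Cmp (rmod_cat B) (omap (G7 G A C x i) U) (amap (G7 G A C x i) V W g) (amap (G7 G A C x i) U V f)"
    using G7_amap_closed[OF U V f]
    by (auto simp: G7_def gcomod_cat_def rmod_cat_def gcomod_compose_def compose_def G7_memD
        intro!: restrict_ext)
qed

section \<open>The adjunction\<close>

definition adjunct ::
  "('b, 'n) right_module \<Rightarrow> ('g \<Rightarrow> ('n \<times> 'a \<Rightarrow>\<^sub>0 int) set \<Rightarrow> 'm) \<Rightarrow> 'n \<Rightarrow> 'g \<Rightarrow> 'm" where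
  "adjunct N h = (\<lambda>n\<in>carrier N. \<lambda>\<alpha>\<in>carrier G. h \<alpha> (unit_el N n))"

abbreviation "F\<^sub>7 \<equiv> omap (F7 G A C x B i)"

lemma omap_F6: "omap (F6 A C x B i) N = F\<^sub>6 N"
  by (simp add: F6_def)

lemma F7_simps:
  "gcomp (F\<^sub>7 N) \<alpha> = induced N" "gcoact (F\<^sub>7 N) \<alpha> \<beta> = coact (F\<^sub>6 N) \<beta>"
  by (simp_all add: F7_def comp_functor_def G1_def F6_def F6_obj_truncate)

text \<open>
  The coaction of \<open>n \<otimes> 1\<close> is \<open>(n \<otimes> 1) \<otimes> x\<^sub>\<beta>\<close>, that is, the family of all copies of \<open>n \<otimes> 1\<close> is coinvariant;
  a morphism \<open>h\<close> preserves this.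
\<close>

lemma adjunct_rmod_hom:
  assumes N: "right_module B N" and M: "gcomodule G A C M" and h: "h \<in> gcomod_hom G A C (F\<^sub>7 N) M"
  shows "adjunct N h \<in> rmod_hom B N (G\<^sub>7 M)"
proof -
  interpret M: gcomodule G A C M by (rule M)
  note hD = gcomod_homD[OF h, unfolded F7_simps]
  note closed = unit_el_closed[OF N]
  have "right_linear B N (G\<^sub>7 M) (\<lambda>n. \<lambda>\<alpha>\<in>carrier G. h \<alpha> (unit_el N n))"
    unfolding right_linear_def
  proof (intro conjI ballI add_homI)
    fix n assume n: "n \<in> carrier N"
    show "(\<lambda>\<alpha>\<in>carrier G. h \<alpha> (unit_el N n)) \<in> carrier (G\<^sub>7 M)"
    proof (rule G7_memI)
      fix \<alpha> \<beta> assume \<alpha>: "\<alpha> \<in> carrier G"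
      then show "h \<alpha> (unit_el N n) \<in> carrier (gcomp M \<alpha>)"
        using right_linear_closed[OF hD(3) closed[OF n]] by simp
      assume \<beta>: "\<beta> \<in> carrier G"
      note C = comp_bimodule[OF \<beta>]
      have "gcoact M \<alpha> \<beta> (h (\<alpha> \<otimes>\<^bsub>G\<^esub> \<beta>) (unit_el N n)) =
          tensor_map A (gcomp M \<alpha>) (ccomp C \<beta>) (h \<alpha>) id (coact (F\<^sub>6 N) \<beta> (unit_el N n))"
        using hD(4)[OF \<alpha> \<beta> closed[OF n]] by simp
      also have "\<dots> = tensor_el A (gcomp M \<alpha>) (ccomp C \<beta>) (h \<alpha> (unit_el N n)) (x \<beta>)"
        using tensor_map_el[OF induced_right_module[OF N] C M.gcomp_module[OF \<alpha>] C hD(3)[OF \<alpha>] bilinear_map_id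
            closed[OF n] x_closed[OF \<beta>]]
        by (simp add: F6_coact_unit[OF N \<beta> n])
      finally show "gcoact M \<alpha> \<beta> (h (\<alpha> \<otimes>\<^bsub>G\<^esub> \<beta>) (unit_el N n)) =
          tensor_el A (gcomp M \<alpha>) (ccomp C \<beta>) (h \<alpha> (unit_el N n)) (x \<beta>)" .
    qed
    show "(\<lambda>\<alpha>\<in>carrier G. h \<alpha> (unit_el N (n \<oplus>\<^bsub>N\<^esub> n'))) =
        (\<lambda>\<alpha>\<in>carrier G. h \<alpha> (unit_el N n)) \<oplus>\<^bsub>G\<^sub>7 M\<^esub> (\<lambda>\<alpha>\<in>carrier G. h \<alpha> (unit_el N n'))"
      if n': "n' \<in> carrier N" for n'
      using closed[OF n] closed[OF n']
      by (auto simp: G7_simps unit_el_add[OF N n n'] add_hom_add[OF right_linear_add_hom[OF hD(3)]]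
          intro!: restrict_ext)
    show "(\<lambda>\<alpha>\<in>carrier G. h \<alpha> (unit_el N (ract N n b))) =
        ract (G\<^sub>7 M) (\<lambda>\<alpha>\<in>carrier G. h \<alpha> (unit_el N n)) b"
      if b: "b \<in> carrier B" for b
      using closed[OF n] i_closed[OF b]
      by (auto simp: G7_simps unit_el_ract[OF N n b] right_linear_ract[OF hD(3)] intro!: restrict_ext)
  qed
  then show ?thesis
    unfolding adjunct_def by (rule rmod_hom_restrict[OF N])
qed

lemma adjunct_inj:
  assumes N: "right_module B N" and M: "gcomodule G A C M"
  shows "inj_on (adjunct N) (gcomod_hom G A C (F\<^sub>7 N) M)"
proof (rule inj_onI)
  interpret M: gcomodule G A C M by (rule M)
  fix h k assume h: "h \<in> gcomod_hom G A C (F\<^sub>7 N) M" and k: "k \<in> gcomod_hom G A C (F\<^sub>7 N) M"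
    and eq: "adjunct N h = adjunct N k"
  note hD = gcomod_homD[OF h, unfolded F7_simps] and kD = gcomod_homD[OF k, unfolded F7_simps]
  have unit: "h \<alpha> (unit_el N n) = k \<alpha> (unit_el N n)" if "\<alpha> \<in> carrier G" "n \<in> carrier N" for \<alpha> n
    using fun_cong[OF fun_cong[OF eq], of n \<alpha>] that by (simp add: adjunct_def)
  show "h = k"
  proof (rule extensionalityI[OF hD(1) kD(1)])
    fix \<alpha> assume \<alpha>: "\<alpha> \<in> carrier G"
    show "h \<alpha> = k \<alpha>"
    proof (rule extensionalityI[of _ "carrier (induced N)"])
      show "h \<alpha> \<in> extensional (carrier (induced N))" "k \<alpha> \<in> extensional (carrier (induced N))"
        using hD(2)[OF \<alpha>] kD(2)[OF \<alpha>] by (simp_all add: rmod_hom_def)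
      show "h \<alpha> t = k \<alpha> t" if "t \<in> carrier (induced N)" for t
        by (rule induced_eqI[OF N M.gcomp_module[OF \<alpha>] hD(3)[OF \<alpha>] kD(3)[OF \<alpha>] unit[OF \<alpha>] that])
    qed
  qed
qed

text \<open>
  The preimage of \<open>k\<close> is \<open>h\<^sub>\<alpha>(n \<otimes> a) = k(n)\<^sub>\<alpha> a\<close>, balanced because \<open>k\<close> is \<open>B\<close>-linear. It is
  compatible with the coactions because, at \<open>n \<otimes> 1\<close>, this is the coinvariance of \<open>k(n)\<close>.
\<close>

lemma adjunct_surj:
  assumes N: "right_module B N" and M: "gcomodule G A C M" and k: "k \<in> rmod_hom B N (G\<^sub>7 M)"
  obtains h where "h \<in> gcomod_hom G A C (F\<^sub>7 N) M" "adjunct N h = k"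
proof
  interpret M: gcomodule G A C M by (rule M)
  interpret N: tensor_factors B A N A\<^sub>B by (rule induced_factors[OF N])
  note k_linear = rmod_hom_right_linear[OF k]
  note k_mem = G7_memD[OF right_linear_closed[OF k_linear]]
  have k_add: "k (n \<oplus>\<^bsub>N\<^esub> n') \<alpha> = k n \<alpha> \<oplus>\<^bsub>gcomp M \<alpha>\<^esub> k n' \<alpha>"
    if "n \<in> carrier N" "n' \<in> carrier N" "\<alpha> \<in> carrier G" for n n' \<alpha>
    using add_hom_add[OF right_linear_add_hom[OF k_linear] that(1,2)] that(3) by (simp add: G7_simps)
  have k_ract: "k (ract N n b) \<alpha> = ract (gcomp M \<alpha>) (k n \<alpha>) (i b)"
    if "n \<in> carrier N" "b \<in> carrier B" "\<alpha> \<in> carrier G" for n b \<alpha>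
    using right_linear_ract[OF k_linear that(1,2)] that(3) by (simp add: G7_simps)
  define h where "h = (\<lambda>\<alpha>\<in>carrier G. \<lambda>t\<in>carrier (induced N).
    tensor_lift (gcomp M \<alpha>) (\<lambda>n a. ract (gcomp M \<alpha>) (k n \<alpha>) a) t)"
  have balanced: "balanced_map B N A\<^sub>B (gcomp M \<alpha>) (\<lambda>n a. ract (gcomp M \<alpha>) (k n \<alpha>) a)"
    if \<alpha>: "\<alpha> \<in> carrier G" for \<alpha>
  proof -
    interpret M\<^sub>\<alpha>: right_module A "gcomp M \<alpha>" by (rule M.gcomp_module[OF \<alpha>])
    show ?thesis
      by (intro balanced_mapI add_homI)
        (use \<alpha> k_mem(2) in \<open>simp_all add: ring_bimodule_simps M\<^sub>\<alpha>.ract_closed M\<^sub>\<alpha>.ract_add M\<^sub>\<alpha>.add_ract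
          M\<^sub>\<alpha>.ract_mult k_add k_ract i_closed\<close>)
  qed
  have h_hom: "h \<alpha> \<in> rmod_hom A (induced N) (gcomp M \<alpha>)" if \<alpha>: "\<alpha> \<in> carrier G" for \<alpha>
  proof -
    have "right_linear A (induced N) (gcomp M \<alpha>)
        (tensor_lift (gcomp M \<alpha>) (\<lambda>n a. ract (gcomp M \<alpha>) (k n \<alpha>) a))"
      by (rule N.tensor_lift_right_linear[OF M.gcomp_module[OF \<alpha>] balanced[OF \<alpha>]])
        (use \<alpha> k_mem(2) in \<open>simp add: ring_bimodule_simps right_module.ract_mult[OF M.gcomp_module]\<close>)
    then show ?thesis
      using rmod_hom_restrict[OF induced_right_module[OF N]] \<alpha> by (simp add: h_def)
  qed
  note h_linear = rmod_hom_right_linear[OF h_hom]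
  have h_unit: "h \<alpha> (unit_el N n) = k n \<alpha>" if \<alpha>: "\<alpha> \<in> carrier G" and n: "n \<in> carrier N" for \<alpha> n
  proof -
    interpret M\<^sub>\<alpha>: right_module A "gcomp M \<alpha>" by (rule M.gcomp_module[OF \<alpha>])
    show ?thesis
      using N.tensor_lift_el[OF M\<^sub>\<alpha>.abelian_group_axioms balanced[OF \<alpha>] n, of "\<one>\<^bsub>A\<^esub>"] \<alpha> n
      by (simp add: h_def ring_bimodule_simps unit_el_closed[OF N] M\<^sub>\<alpha>.ract_one k_mem(2))
  qed
  show "h \<in> gcomod_hom G A C (F\<^sub>7 N) M"
  proof (rule gcomod_homI, unfold F7_simps)
    show "h \<in> extensional (carrier G)" by (simp add: h_def)
    show "h \<alpha> \<in> rmod_hom A (induced N) (gcomp M \<alpha>)" if "\<alpha> \<in> carrier G" for \<alpha>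
      by (rule h_hom[OF that])
    fix \<alpha> \<beta> t assume \<alpha>: "\<alpha> \<in> carrier G" and \<beta>: "\<beta> \<in> carrier G" and t: "t \<in> carrier (induced N)"
    have \<alpha>\<beta>: "\<alpha> \<otimes>\<^bsub>G\<^esub> \<beta> \<in> carrier G" using \<alpha> \<beta> by simp
    note C = comp_bimodule[OF \<beta>]
    note args = induced_right_module[OF N] C M.gcomp_module[OF \<alpha>] C h_linear[OF \<alpha>] bilinear_map_id
    have MC: "right_module A (tensor A (gcomp M \<alpha>) (ccomp C \<beta>))"
      by (rule tensor_factors.tensor_right_module[OF tensor_factors.intro[OF M.gcomp_module[OF \<alpha>] C]])
    show "tensor_map A (gcomp M \<alpha>) (ccomp C \<beta>) (h \<alpha>) id (coact (F\<^sub>6 N) \<beta> t) =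
        gcoact M \<alpha> \<beta> (h (\<alpha> \<otimes>\<^bsub>G\<^esub> \<beta>) t)"
      by (rule induced_eqI[OF N MC
            right_linear_comp[OF F6_coact_linear[OF N \<beta>] tensor_map_right_linear[OF args]]
            right_linear_comp[OF h_linear[OF \<alpha>\<beta>] M.gcoact_linear[OF \<alpha> \<beta>]] _ t])
        (simp add: F6_coact_unit[OF N \<beta>] tensor_map_el[OF args] unit_el_closed[OF N] x_closed[OF \<beta>]
          h_unit[OF \<alpha>] h_unit[OF \<alpha>\<beta>] k_mem(3)[OF _ \<alpha> \<beta>])
  qed
  show "adjunct N h = k"
  proof (rule extensionalityI[of _ "carrier N"])
    show "adjunct N h \<in> extensional (carrier N)" by (simp add: adjunct_def)
    show "k \<in> extensional (carrier N)" using k by (simp add: rmod_hom_def)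
    fix n assume n: "n \<in> carrier N"
    show "adjunct N h n = k n"
      by (rule extensionalityI[of _ "carrier G"])
        (use n k_mem(1)[OF n] in \<open>simp_all add: adjunct_def h_unit\<close>)
  qed
qed

lemma bij_betw_adjunct:
  assumes N: "right_module B N" and M: "gcomodule G A C M"
  shows "bij_betw (adjunct N) (gcomod_hom G A C (F\<^sub>7 N) M) (rmod_hom B N (G\<^sub>7 M))"
proof (rule bij_betw_imageI[OF adjunct_inj[OF N M]])
  show "adjunct N ` gcomod_hom G A C (F\<^sub>7 N) M = rmod_hom B N (G\<^sub>7 M)"
    using adjunct_rmod_hom[OF N M] adjunct_surj[OF N M] by blast
qed

lemma adjunct_natural_left:
  assumes N: "right_module B N" and N': "right_module B N'" and f: "f \<in> rmod_hom B N' N"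
  shows "adjunct N' (gcomod_compose G (F\<^sub>7 N') h (amap (F7 G A C x B i) N' N f)) =
    compose (carrier N') (adjunct N h) f"
  using F6_amap_unit[OF N' N f] right_linear_closed[OF rmod_hom_right_linear[OF f]]
  by (auto simp: adjunct_def compose_def gcomod_compose_def F7_simps unit_el_closed[OF N']
      F7_def comp_functor_def G1_def omap_F6 intro!: restrict_ext)

lemma adjunct_natural_right:
  assumes N: "right_module B N" and M: "gcomodule G A C M" and h: "h \<in> gcomod_hom G A C (F\<^sub>7 N) M"
  shows "adjunct N (gcomod_compose G (F\<^sub>7 N) g h) =
    compose (carrier N) (amap (G7 G A C x i) M M' g) (adjunct N h)"
proof -
  have "adjunct N h n \<in> carrier (G\<^sub>7 M)" if "n \<in> carrier N" for n
    using right_linear_closed[OF rmod_hom_right_linear[OF adjunct_rmod_hom[OF N M h]] that] .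
  then have "compose (carrier N) (amap (G7 G A C x i) M M' g) (adjunct N h) =
      (\<lambda>n\<in>carrier N. \<lambda>\<alpha>\<in>carrier G. g \<alpha> (adjunct N h n \<alpha>))"
    by (simp add: compose_def G7_def cong: restrict_cong)
  then show ?thesis
    by (simp add: adjunct_def gcomod_compose_def F7_simps compose_def unit_el_closed[OF N] cong: restrict_cong)
qed

end

theorem proposition5p4:
  fixes G :: "'g monoid" and A :: "'a ring" and B :: "'b ring"
    and C :: "('g, 'a, 'c) group_coring" and x :: "'g \<Rightarrow> 'c" and i :: "'b \<Rightarrow> 'a"
  assumes "group_coring G A C"
    and "grouplike_family G A C x"
    and "ring B"
    and "i \<in> ring_hom B (coinvariant_ring G A C x)"
  shows
    "cat_functor (rmod_cat B :: (('b, 'n) right_module, 'n \<Rightarrow> 'n) category)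
       (comod_cat G A C) (F6 A C x B i) \<and>
     cat_functor (comod_cat G A C :: (('a, 'm, 'g, 'c) comodule, 'm \<Rightarrow> 'm) category)
       (gcomod_cat G A C) (G1 G) \<and>
     cat_functor (rmod_cat B :: (('b, 'n) right_module, 'n \<Rightarrow> 'n) category)
       (gcomod_cat G A C) (F7 G A C x B i) \<and>
     cat_functor
       (gcomod_cat G A C :: (('a, 'm, 'g, 'c) gcomodule, 'g \<Rightarrow> 'm \<Rightarrow> 'm) category)
       (rmod_cat B) (G7 G A C x i) \<and>
     (\<exists>\<phi> :: ('b, 'n) right_module \<Rightarrow> ('a, 'm, 'g, 'c) gcomodule \<Rightarrow>
             ('g \<Rightarrow> ('n \<times> 'a \<Rightarrow>\<^sub>0 int) set \<Rightarrow> 'm) \<Rightarrow> ('n \<Rightarrow> 'g \<Rightarrow> 'm).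
        (\<forall>N\<in>Ob (rmod_cat B). \<forall>M\<in>Ob (gcomod_cat G A C).
           bij_betw (\<phi> N M)
             (gcomod_hom G A C (omap (F7 G A C x B i) N) M)
             (rmod_hom B N (omap (G7 G A C x i) M))) \<and>
        (\<forall>N\<in>Ob (rmod_cat B). \<forall>N'\<in>Ob (rmod_cat B). \<forall>M\<in>Ob (gcomod_cat G A C).
           \<forall>f\<in>Hom (rmod_cat B) N' N.
           \<forall>h\<in>gcomod_hom G A C (omap (F7 G A C x B i) N) M.
             \<phi> N' M (gcomod_compose G (omap (F7 G A C x B i) N') h (amap (F7 G A C x B i) N' N f)) =
             compose (carrier N') (\<phi> N M h) f) \<and>
        (\<forall>N\<in>Ob (rmod_cat B). \<forall>M\<in>Ob (gcomod_cat G A C). \<forall>M'\<in>Ob (gcomod_cat G A C).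
           \<forall>g\<in>Hom (gcomod_cat G A C) M M'.
           \<forall>h\<in>gcomod_hom G A C (omap (F7 G A C x B i) N) M.
             \<phi> N M' (gcomod_compose G (omap (F7 G A C x B i) N) g h) =
             compose (carrier N) (amap (G7 G A C x i) M M' g) (\<phi> N M h)))"
proof -
  interpret grouplike_coring G A C x B i
    using assms by (simp add: grouplike_coring_def grouplike_coring_axioms_def)
  have [simp]: "N \<in> Ob (rmod_cat B) \<longleftrightarrow> right_module B N" for N :: "('b, 'n) right_module"
    by (simp add: rmod_cat_def)
  have [simp]: "M \<in> Ob (gcomod_cat G A C) \<longleftrightarrow> gcomodule G A C M" for M :: "('a, 'm, 'g, 'c) gcomodule"
    by (simp add: gcomod_cat_def)
  show ?thesis
  proof (intro conjI exI[of _ "\<lambda>N M. adjunct N"] ballI)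
    fix N :: "('b, 'n) right_module" and M :: "('a, 'm, 'g, 'c) gcomodule"
    assume "N \<in> Ob (rmod_cat B)" "M \<in> Ob (gcomod_cat G A C)"
    then show "bij_betw (adjunct N) (gcomod_hom G A C (omap (F7 G A C x B i) N) M)
        (rmod_hom B N (omap (G7 G A C x i) M))"
      using bij_betw_adjunct[of N M] by (simp add: G7_def)
  next
    fix N N' :: "('b, 'n) right_module" and f h
    assume "N \<in> Ob (rmod_cat B)" "N' \<in> Ob (rmod_cat B)" "f \<in> Hom (rmod_cat B) N' N"
    then show "adjunct N' (gcomod_compose G (omap (F7 G A C x B i) N') h (amap (F7 G A C x B i) N' N f)) =
        compose (carrier N') (adjunct N h) f"
      using adjunct_natural_left[of N N' f h] by (simp add: rmod_cat_def)
  next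
    fix N :: "('b, 'n) right_module" and M M' :: "('a, 'm, 'g, 'c) gcomodule" and g h
    assume "N \<in> Ob (rmod_cat B)" "M \<in> Ob (gcomod_cat G A C)"
      "h \<in> gcomod_hom G A C (omap (F7 G A C x B i) N) M"
    then show "adjunct N (gcomod_compose G (omap (F7 G A C x B i) N) g h) =
        compose (carrier N) (amap (G7 G A C x i) M M' g) (adjunct N h)"
      using adjunct_natural_right[of N M h g M'] by simp
  qed (rule cat_functor_F6 cat_functor_G1 cat_functor_F7 cat_functor_G7)+
qed

end
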